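(* Let $\mathbb{F}$ be a field. Up to isomorphism there is a unique nilpotent symplectic alternating algebra $L$ over $\mathbb{F}$ of dimension $10$ that has an isotropic center of dimension $2$ with the further properties that the class of $L$ is $7$, $L^{4}L^{3}=L^{7}$ and $\dim UL^{2}=1$, where $U=U(L)$ is the characteristic ideal defined in the context. This algebra can be given by the presentation $$\mathcal{P}_{10}^{(2,3)}:\ (x_{3}y_{4},y_{5})=1,\ (x_{2}y_{3},y_{5})=1,\ (x_{1}y_{2},y_{5})=1,\ (y_{1}y_{2},y_{4})=1.$$
   Context: A symplectic alternating algebra (SAA) over a field $\mathbb{F}$ is a finite-dimensional $\mathbb{F}$-vector space $L$ with a non-degenerate alternating bilinear form $(\cdot,\cdot)$ and a bilinear alternating product $L\times L\to L$, $(x,y)\mapsto xy$ (so $xx=0$), such that $(xy,z)=(yz,x)$ for all $x,y,z\in L$. Consequently $(u,v,w)\mapsto (uv,w)$ is an alternating trilinear form, and by non-degeneracy it determines the product. An isomorphism of SAAs is a linear bijection preserving both the product and the form. For subspaces $A,B\le L$, $AB$ denotes the linear span of all products $ab$ with $a\in A$, $b\in B$. Put $L^{1}=L$, $L^{k+1}=L^{k}L$; $L$ is nilpotent if $L^{k+1}=0$ for some $k$, and the smallest such $k$ is its (nilpotence) class. The center is $Z(L)=\{z\in L: zx=0 \text{ for all } x\in L\}$. A subspace $A$ is isotropic if $(u,v)=0$ for all $u,v\in A$. A standard basis of a $10$-dimensional $L$ is a basis $x_{1},y_{1},\ldots,x_{5},y_{5}$ with $(x_i,x_j)=(y_i,y_j)=0$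 and $(x_i,y_j)=\delta_{ij}$. A nilpotent presentation lists values of the triples $(x_iy_j,y_k)$ and $(y_iy_j,y_k)$ with $1\le i<j<k\le 5$ with respect to a standard basis. By convention, all triple values $(uv,w)$ of basis vectors $u,v,w$ which do not follow from the listed ones by the alternating property are $0$. Such a presentation determines an SAA up to isomorphism. Definition of $U$: let $L$ be a nilpotent SAA of dimension $10$ and class $7$ with isotropic center of dimension $2$ (then $L^4L^3$ is a $2$-dimensional subspace of $L^6$). Put $I_{1}=L^{5}L^{2}$, $I_{2}=L^{7}$, $I_{3}=L^{6}$, and let $k$ be the smallest index such that $I_{k}\cap L^{4}L^{3}\neq\{0\}$. Then $U=\{x\in L^{4}: xL^{3}\leq I_{k}\}$, a characteristic ideal of dimension $5$. *)

theory Defs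
  imports "HOL-Analysis.Cartesian_Space"
begin

text \<open>
  The underlying vector space is a whole type \<open>'v\<close> with scalar multiplication \<open>smul\<close>
  over a field type \<open>'a\<close>.
\<close>

locale symplectic_alternating_algebra = vector_space smul
  for smul :: "'a::field \<Rightarrow> 'v::ab_group_add \<Rightarrow> 'v" +
  fixes form :: "'v \<Rightarrow> 'v \<Rightarrow> 'a"
    and mul :: "'v \<Rightarrow> 'v \<Rightarrow> 'v"
  assumes finite_dimensional: "\<exists>B. finite B \<and> span B = UNIV"
    and form_linear_left: "Vector_Spaces.linear smul (*) (\<lambda>x. form x y)"
    and form_linear_right: "Vector_Spaces.linear smul (*) (\<lambda>y. form x y)"
    and form_alternating: "form x x = 0"
    and form_nondegenerate: "(\<forall>y. form x y = 0) \<Longrightarrow> x = 0"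
    and mul_linear_left: "Vector_Spaces.linear smul smul (\<lambda>x. mul x y)"
    and mul_linear_right: "Vector_Spaces.linear smul smul (\<lambda>y. mul x y)"
    and mul_alternating: "mul x x = 0"
    and form_mul_cyclic: "form (mul x y) z = form (mul y z) x"

text \<open>
  Labels for the members \<open>x\<^sub>i\<close>, \<open>y\<^sub>i\<close> of a standard basis, and a listing of triple values:
  an entry \<open>((u, v, w), c)\<close> stands for \<open>(uv, w) = c\<close>.
\<close>

datatype basis_label = X nat | Y nat

definition basis_labels :: "nat \<Rightarrow> basis_label set" where
  "basis_labels n = X ` {1..n} \<union> Y ` {1..n}"

type_synonym 'a presentation = "((basis_label \<times> basis_label \<times> basis_label) \<times> 'a) set"

context symplectic_alternating_algebra
begin

definition set_prod :: "'v set \<Rightarrow> 'v set \<Rightarrow> 'v set" where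
  "set_prod A B = span {mul a b |a b. a \<in> A \<and> b \<in> B}"

text \<open>
  The lower central series \<open>L\<^sup>1 = L\<close>, \<open>L\<^sup>k\<^sup>+\<^sup>1 = L\<^sup>k L\<close>, indexed from 1. The value at
  index 0 is a dummy.
\<close>

fun lcs :: "nat \<Rightarrow> 'v set" where
  "lcs 0 = UNIV"
| "lcs (Suc 0) = UNIV"
| "lcs (Suc (Suc k)) = set_prod (lcs (Suc k)) UNIV"

definition nilpotent :: bool where
  "nilpotent \<longleftrightarrow> (\<exists>k. lcs (k + 1) = {0})"

definition nilpotence_class :: nat where
  "nilpotence_class = (LEAST k. lcs (k + 1) = {0})"

definition center :: "'v set" where
  "center = {z. \<forall>x. mul z x = 0}"

definition isotropic :: "'v set \<Rightarrow> bool" where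
  "isotropic A \<longleftrightarrow> (\<forall>u\<in>A. \<forall>v\<in>A. form u v = 0)"

text \<open>
  The ideal \<open>U\<close> is meaningful only for nilpotent algebras of dimension 10 and class 7 with
  isotropic center of dimension 2; these are the only algebras it is used for below.
\<close>

definition U_ideal :: "nat \<Rightarrow> 'v set" where
  "U_ideal k =
     (if k = 1 then set_prod (lcs 5) (lcs 2) else if k = 2 then lcs 7 else lcs 6)"

definition U_index :: nat where
  "U_index = (LEAST k. k \<in> {1, 2, 3} \<and> U_ideal k \<inter> set_prod (lcs 4) (lcs 3) \<noteq> {0})"

definition U :: "'v set" where
  "U = {x \<in> lcs 4. \<forall>a \<in> lcs 3. mul x a \<in> U_ideal U_index}"

definition standard_basis :: "nat \<Rightarrow> (basis_label \<Rightarrow> 'v) \<Rightarrow> bool" where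
  "standard_basis n b \<longleftrightarrow>
     inj_on b (basis_labels n) \<and> independent (b ` basis_labels n) \<and>
     span (b ` basis_labels n) = UNIV \<and>
     (\<forall>i\<in>{1..n}. \<forall>j\<in>{1..n}.
        form (b (X i)) (b (X j)) = 0 \<and> form (b (Y i)) (b (Y j)) = 0 \<and>
        form (b (X i)) (b (Y j)) = (if i = j then 1 else 0))"

text \<open>
  Every listed triple in a nilpotent presentation consists of three distinct basis vectors, so
  the values that follow from the listed ones by the alternating property are exactly those at
  rearrangements of listed triples, that is, at triples with the same set of members.
\<close>

definition has_presentation :: "nat \<Rightarrow> 'a presentation \<Rightarrow> bool" where
  "has_presentation n P \<longleftrightarrow>
     (\<exists>b. standard_basis n b \<and>
        (\<forall>((u, v, w), c) \<in> P. form (mul (b u) (b v)) (b w) = c) \<and>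
        (\<forall>u \<in> basis_labels n. \<forall>v \<in> basis_labels n. \<forall>w \<in> basis_labels n.
           (\<nexists>u' v' w' c. ((u', v', w'), c) \<in> P \<and> {u, v, w} = {u', v', w'}) \<longrightarrow>
           form (mul (b u) (b v)) (b w) = 0))"

end

definition saa_isomorphic ::
  "('a::field \<Rightarrow> 'v::ab_group_add \<Rightarrow> 'v) \<Rightarrow> ('v \<Rightarrow> 'v \<Rightarrow> 'a) \<Rightarrow> ('v \<Rightarrow> 'v \<Rightarrow> 'v) \<Rightarrow>
   ('a \<Rightarrow> 'w::ab_group_add \<Rightarrow> 'w) \<Rightarrow> ('w \<Rightarrow> 'w \<Rightarrow> 'a) \<Rightarrow> ('w \<Rightarrow> 'w \<Rightarrow> 'w) \<Rightarrow> bool" where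
  "saa_isomorphic smul form mul smul' form' mul' \<longleftrightarrow>
     (\<exists>f. Vector_Spaces.linear smul smul' f \<and> bij f \<and>
        (\<forall>x y. f (mul x y) = mul' (f x) (f y)) \<and>
        (\<forall>x y. form' (f x) (f y) = form x y))"

locale saa_10_2_3 = symplectic_alternating_algebra +
  assumes nilpotent: "nilpotent"
    and dim_eq_10: "dim UNIV = 10"
    and isotropic_center: "isotropic center"
    and dim_center: "dim center = 2"
    and class_eq_7: "nilpotence_class = 7"
    and L4_L3: "set_prod (lcs 4) (lcs 3) = lcs 7"
    and dim_U_L2: "dim (set_prod U (lcs 2)) = 1"

definition presentation_10_2_3 :: "'a::field presentation" where
  "presentation_10_2_3 =
     {((X 3, Y 4, Y 5), 1), ((X 2, Y 3, Y 5), 1), ((X 1, Y 2, Y 5), 1), ((Y 1, Y 2, Y 4), 1)}"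

end

(*
  The form is invariant, so the orthogonal complement of L^k is L^(9-k), and dimension counting
  gives the dimensions 10, 8, 7, 6, 4, 3, 2, 0 for the lower central series. The conditions
  L^4 L^3 = L^7 and dim U L^2 = 1 make L^5 L^2 one-dimensional and U a Lagrangian subspace, so
  that L^5 L^2 < L^7 < L^6 < L^5 < U is a complete flag of U. In a symplectic basis
  x_1, y_1, ..., x_5, y_5 whose x_i are adapted to this flag only the triples
    (x_i y_j, y_5) with i < j < 5  and  (y_i y_j, y_k) other than (y_1 y_2, y_3)
  can be nonzero, and (x_3 y_4, y_5), (x_2 y_3, y_5), (x_1 y_2, y_5), (y_1 y_2, y_4) are nonzero.
  Elementary symplectic changes of basis kill all the other triples, and rescaling turns these
  four into 1; a basis with this presentation determines the algebra. Conversely, everything in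
  the hypotheses can be read off from the structure constants of the presentation.
*)

theory Submission
  imports Defs
begin

subsection \<open>Orthogonality and the lower central series\<close>

text \<open>The field is arbitrary, so neither division by 2 nor extraction of roots is available;
  the correction of dual vectors to a symplectic basis and the final rescaling are shaped by this.
  Most arguments about the flag rest on one principle: an alternating map that factors through a
  one-dimensional quotient vanishes. It excludes dim L^7 = 1 and the dimensions 5, 4 for L^4, L^5,
  it gives L^2 L^2 <= L^4 and hence L^5 L^2 <= L^7, and it makes U isotropic. The hypothesis on U
  enters by contradiction. If L^5 L^2 were 0 or all of L^7, then U would be L^4, and U L^2 would
  contain L^4 L^3 = L^7, of dimension 2. So L^5 L^2 is a line strictly between. For the converse,
  for uniqueness and for existence, form and product are written as fixed polynomial formulas in ten
  coordinates, which do not mention the algebra. Algebras with the presentation are then compared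
  through their coordinates, and the same formulas define a model.\<close>

context symplectic_alternating_algebra
begin

lemma form_add_left: "form (x + x') y = form x y + form x' y"
  and form_scale_left: "form (smul c x) y = c * form x y"
  and form_minus_left: "form (- x) y = - form x y"
  and form_diff_left: "form (x - x') y = form x y - form x' y"
  and form_zero_left: "form 0 y = 0"
proof -
  interpret l: Vector_Spaces.linear smul "(*)" "\<lambda>x. form x y"
    by (rule form_linear_left)
  show "form (x + x') y = form x y + form x' y" by (rule l.add)
  show "form (smul c x) y = c * form x y" by (rule l.scale)
  show "form (- x) y = - form x y" by (rule l.neg)
  show "form (x - x') y = form x y - form x' y" by (rule l.diff)
  show "form 0 y = 0" by (rule l.zero)
qed

lemma form_add_right: "form x (y + y') = form x y + form x y'"
  and form_scale_right: "form x (smul c y) = c * form x y"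
  and form_minus_right: "form x (- y) = - form x y"
  and form_diff_right: "form x (y - y') = form x y - form x y'"
  and form_zero_right: "form x 0 = 0"
proof -
  interpret l: Vector_Spaces.linear smul "(*)" "\<lambda>y. form x y"
    by (rule form_linear_right)
  show "form x (y + y') = form x y + form x y'" by (rule l.add)
  show "form x (smul c y) = c * form x y" by (rule l.scale)
  show "form x (- y) = - form x y" by (rule l.neg)
  show "form x (y - y') = form x y - form x y'" by (rule l.diff)
  show "form x 0 = 0" by (rule l.zero)
qed

lemma mul_add_left: "mul (x + x') y = mul x y + mul x' y"
  and mul_scale_left: "mul (smul c x) y = smul c (mul x y)"
  and mul_minus_left: "mul (- x) y = - mul x y"
  and mul_diff_left: "mul (x - x') y = mul x y - mul x' y"
  and mul_zero_left: "mul 0 y = 0"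
proof -
  interpret l: Vector_Spaces.linear smul smul "\<lambda>x. mul x y"
    by (rule mul_linear_left)
  show "mul (x + x') y = mul x y + mul x' y" by (rule l.add)
  show "mul (smul c x) y = smul c (mul x y)" by (rule l.scale)
  show "mul (- x) y = - mul x y" by (rule l.neg)
  show "mul (x - x') y = mul x y - mul x' y" by (rule l.diff)
  show "mul 0 y = 0" by (rule l.zero)
qed

lemma mul_add_right: "mul x (y + y') = mul x y + mul x y'"
  and mul_scale_right: "mul x (smul c y) = smul c (mul x y)"
  and mul_minus_right: "mul x (- y) = - mul x y"
  and mul_diff_right: "mul x (y - y') = mul x y - mul x y'"
  and mul_zero_right: "mul x 0 = 0"
proof -
  interpret l: Vector_Spaces.linear smul smul "\<lambda>y. mul x y"
    by (rule mul_linear_right)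
  show "mul x (y + y') = mul x y + mul x y'" by (rule l.add)
  show "mul x (smul c y) = smul c (mul x y)" by (rule l.scale)
  show "mul x (- y) = - mul x y" by (rule l.neg)
  show "mul x (y - y') = mul x y - mul x y'" by (rule l.diff)
  show "mul x 0 = 0" by (rule l.zero)
qed

lemmas form_linear =
  form_add_left form_scale_left form_minus_left form_diff_left form_zero_left
  form_add_right form_scale_right form_minus_right form_diff_right form_zero_right

lemmas mul_linear =
  mul_add_left mul_scale_left mul_minus_left mul_diff_left mul_zero_left
  mul_add_right mul_scale_right mul_minus_right mul_diff_right mul_zero_right

lemma form_skew: "form y x = - form x y"
proof -
  have "form (x + y) (x + y) = form x x + form x y + (form y x + form y y)"
    by (simp add: form_linear)
  then show ?thesis
    by (simp add: form_alternating eq_neg_iff_add_eq_0 add.commute)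
qed

lemma form_eq_0_commute: "form y x = 0 \<longleftrightarrow> form x y = 0"
  using form_skew [of x y] form_skew [of y x] by auto

lemma mul_skew: "mul y x = - mul x y"
proof -
  have "mul (x + y) (x + y) = mul x x + mul x y + (mul y x + mul y y)"
    by (simp add: mul_linear)
  then show ?thesis
    by (simp add: mul_alternating eq_neg_iff_add_eq_0 add.commute)
qed

abbreviation triple :: "'v \<Rightarrow> 'v \<Rightarrow> 'v \<Rightarrow> 'a" where
  "triple u v w \<equiv> form (mul u v) w"

lemma triple_cyclic: "triple v w u = triple u v w"
  by (rule form_mul_cyclic [symmetric])

lemma triple_swap12: "triple v u w = - triple u v w"
  by (subst mul_skew) (simp add: form_linear)

lemma triple_swap23: "triple u w v = - triple u v w"
  by (metis triple_cyclic triple_swap12)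

lemma triple_eq_0:
  "triple u u v = 0" "triple u v u = 0" "triple v u u = 0"
  by (metis mul_alternating triple_cyclic form_zero_left)+

text \<open>The algebra comes with a finite spanning set only, whereas the dimension theorems take a
  finite basis as a parameter. The basis obtained here serves to interpret them locally.\<close>

lemma obtain_basis:
  obtains B where "finite_dimensional_vector_space smul B"
proof -
  obtain A where A: "finite A" "span A = UNIV"
    using finite_dimensional by blast
  obtain B where B: "B \<subseteq> UNIV" "independent B" "UNIV \<subseteq> span B"
    using maximal_independent_subset [of UNIV] by blast
  have "finite B"
    using independent_span_bound [OF A(1) B(2)] A by simp
  then have "finite_dimensional_vector_space smul B"
    using B by unfold_locales auto
  then show thesis by (rule that)
qed

lemma fd_dim_subset: "S \<subseteq> T \<Longrightarrow> dim S \<le> dim T"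
proof -
  assume "S \<subseteq> T"
  obtain B where "finite_dimensional_vector_space smul B" by (rule obtain_basis)
  then interpret fd: finite_dimensional_vector_space smul B .
  show ?thesis using \<open>S \<subseteq> T\<close> by (rule fd.dim_subset)
qed

lemma fd_dim_insert: "dim (insert x S) = (if x \<in> span S then dim S else dim S + 1)"
proof -
  obtain B where "finite_dimensional_vector_space smul B" by (rule obtain_basis)
  then interpret fd: finite_dimensional_vector_space smul B .
  show ?thesis by (rule fd.dim_insert)
qed

lemma fd_subspace_dim_equal:
  "subspace S \<Longrightarrow> subspace T \<Longrightarrow> S \<subseteq> T \<Longrightarrow> dim T \<le> dim S \<Longrightarrow> S = T"
proof -
  assume *: "subspace S" "subspace T" "S \<subseteq> T" "dim T \<le> dim S"
  obtain B where "finite_dimensional_vector_space smul B" by (rule obtain_basis)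
  then interpret fd: finite_dimensional_vector_space smul B .
  show ?thesis using * by (rule fd.subspace_dim_equal)
qed

lemma fd_dim_less:
  "subspace S \<Longrightarrow> subspace T \<Longrightarrow> S \<subset> T \<Longrightarrow> dim S < dim T"
  using fd_subspace_dim_equal [of S T] by force

lemma fd_dim_eq_0: "dim S = 0 \<longleftrightarrow> S \<subseteq> {0}"
proof -
  obtain B where "finite_dimensional_vector_space smul B" by (rule obtain_basis)
  then interpret fd: finite_dimensional_vector_space smul B .
  show ?thesis by (rule fd.dim_eq_0)
qed

lemma fd_independent_spans:
  assumes "independent S" and "S \<subseteq> V" and "subspace V" and "dim V \<le> card S"
  shows "span S = V"
proof (rule fd_subspace_dim_equal [OF subspace_span assms(3)])
  show "span S \<subseteq> V"
    using assms by (simp add: span_minimal)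
  show "dim V \<le> dim (span S)"
    unfolding dim_span_eq_card_independent [OF assms(1)] by (rule assms(4))
qed

lemma fd_finite_independent: "independent S \<Longrightarrow> finite S"
proof -
  assume *: "independent S"
  obtain B where "finite_dimensional_vector_space smul B" by (rule obtain_basis)
  then interpret fd: finite_dimensional_vector_space smul B .
  show ?thesis using * by (rule fd.finiteI_independent)
qed

section \<open>Orthogonal complements\<close>

definition perp :: "'v set \<Rightarrow> 'v set" where
  "perp S = {v. \<forall>s\<in>S. form s v = 0}"

lemma subspace_perp: "subspace (perp S)"
  by (auto simp: perp_def subspace_def form_linear)

lemma perp_span: "perp (span S) = perp S"
proof
  show "perp (span S) \<subseteq> perp S"
    by (auto simp: perp_def span_base)
  show "perp S \<subseteq> perp (span S)"
  proof
    fix v assume v: "v \<in> perp S"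
    have "span S \<subseteq> {s. form s v = 0}"
      using v by (intro span_minimal) (auto simp: perp_def subspace_def form_linear)
    then show "v \<in> perp (span S)"
      by (auto simp: perp_def)
  qed
qed

lemma dim_perp_insert_ge: "dim (perp S) \<le> dim (perp (insert s S)) + 1"
proof (cases "perp S \<subseteq> perp (insert s S)")
  case True
  then show ?thesis using fd_dim_subset [OF True] by simp
next
  case False
  then obtain w where w: "w \<in> perp S" "form s w \<noteq> 0"
    by (auto simp: perp_def)
  have "perp S \<subseteq> span (insert w (perp (insert s S)))"
  proof
    fix v assume v: "v \<in> perp S"
    define c where "c = form s v / form s w"
    have "v - smul c w \<in> perp (insert s S)"
      using v w by (auto simp: perp_def form_linear c_def)
    then show "v \<in> span (insert w (perp (insert s S)))"
      unfolding span_breakdown_eq using span_base by blast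
  qed
  then have "dim (perp S) \<le> dim (insert w (perp (insert s S)))"
    using fd_dim_subset dim_span by metis
  then show ?thesis
    by (simp add: fd_dim_insert split: if_splits)
qed

lemma dim_perp_Un_ge: "finite T \<Longrightarrow> dim (perp S) \<le> dim (perp (S \<union> T)) + card T"
proof (induction T rule: finite_induct)
  case (insert t T)
  then show ?case
    using dim_perp_insert_ge [of "S \<union> T" t] by simp
qed simp

text \<open>A basis \<open>A\<close> of the span of \<open>S\<close> is extended to a basis
  \<open>B\<close> of the space. Passing from \<open>perp {}\<close> to \<open>perp A\<close> loses
  at most \<open>card A\<close> dimensions, and passing on to \<open>perp B\<close> at most
  \<open>card (B - A)\<close>. Nondegeneracy makes \<open>perp B\<close> zero, so
  \<open>card B\<close> dimensions are lost in total and both bounds are attained.\<close>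

lemma dim_perp: "dim (perp S) + dim S = dim UNIV"
proof -
  obtain A where A: "A \<subseteq> span S" "independent A" "span S \<subseteq> span A" "card A = dim S"
    using basis_exists [of "span S"] by auto
  have spanA: "span A = span S"
    using A span_minimal [of A "span S"] by blast
  obtain B where B: "A \<subseteq> B" "independent B" "UNIV \<subseteq> span B"
    using maximal_independent_subset_extend [of A UNIV] A by auto
  have fin: "finite B" "finite A"
    using B A fd_finite_independent by auto
  have cB: "card B = dim UNIV"
    using B basis_card_eq_dim by auto
  have "perp B = perp UNIV"
    by (metis B(3) perp_span top.extremum_uniqueI)
  then have pB: "dim (perp B) = 0"
    by (auto simp: fd_dim_eq_0 perp_def form_eq_0_commute intro: form_nondegenerate)
  have p0: "dim (perp {}) = dim UNIV"
    by (simp add: perp_def)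
  have "dim (perp A) \<le> dim (perp (A \<union> (B - A))) + card (B - A)"
    using fin by (intro dim_perp_Un_ge) auto
  moreover have "A \<union> (B - A) = B" using B by auto
  moreover have "card (B - A) = card B - card A"
    using B fin by (simp add: card_Diff_subset)
  moreover have "card A \<le> card B"
    using B fin by (simp add: card_mono)
  moreover have "dim (perp {}) \<le> dim (perp ({} \<union> A)) + card A"
    using fin by (intro dim_perp_Un_ge) auto
  ultimately have "dim (perp A) + card A = dim UNIV"
    using pB cB p0 by simp
  moreover have "perp A = perp S"
    by (metis spanA perp_span)
  ultimately show ?thesis using A by simp
qed

lemma perp_eqI:
  assumes "subspace A" and "\<And>a b. a \<in> A \<Longrightarrow> b \<in> B \<Longrightarrow> form a b = 0"
    and "dim UNIV \<le> dim A + dim B"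
  shows "perp B = A"
proof -
  have "A \<subseteq> perp B"
    using assms(2) form_eq_0_commute by (auto simp: perp_def)
  moreover have "dim (perp B) \<le> dim A"
    using assms(3) dim_perp [of B] by simp
  ultimately show ?thesis
    using fd_subspace_dim_equal assms(1) subspace_perp by metis
qed

lemma orthogonal_dim_le:
  assumes "\<And>a b. a \<in> A \<Longrightarrow> b \<in> B \<Longrightarrow> form a b = 0"
  shows "dim A + dim B \<le> dim UNIV"
proof -
  have "B \<subseteq> perp A"
    using assms by (auto simp: perp_def)
  then show ?thesis
    using dim_perp [of A] fd_dim_subset [of B "perp A"] by simp
qed

section \<open>Products of subspaces and the lower central series\<close>

lemma set_prod_subspace: "subspace (set_prod A B)"
  by (simp add: set_prod_def)

lemma set_prod_base: "a \<in> A \<Longrightarrow> b \<in> B \<Longrightarrow> mul a b \<in> set_prod A B"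
  unfolding set_prod_def by (rule span_base) blast

lemma set_prod_minimal:
  "subspace W \<Longrightarrow> (\<And>a b. a \<in> A \<Longrightarrow> b \<in> B \<Longrightarrow> mul a b \<in> W) \<Longrightarrow> set_prod A B \<subseteq> W"
  unfolding set_prod_def by (rule span_minimal) auto

lemma set_prod_mono: "A \<subseteq> A' \<Longrightarrow> B \<subseteq> B' \<Longrightarrow> set_prod A B \<subseteq> set_prod A' B'"
  by (rule set_prod_minimal [OF set_prod_subspace]) (auto intro: set_prod_base)

lemma mem_perp_set_prod:
  "w \<in> perp (set_prod A B) \<longleftrightarrow> (\<forall>a\<in>A. \<forall>b\<in>B. triple a b w = 0)"
  unfolding set_prod_def perp_span by (auto simp: perp_def)

lemma set_prod_orthogonal:
  "(\<forall>u\<in>set_prod A B. \<forall>w\<in>C. form u w = 0) \<longleftrightarrow> (\<forall>a\<in>A. \<forall>b\<in>B. \<forall>w\<in>C. triple a b w = 0)"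
proof -
  have "(\<forall>u\<in>set_prod A B. \<forall>w\<in>C. form u w = 0) \<longleftrightarrow> (\<forall>w\<in>C. w \<in> perp (set_prod A B))"
    by (auto simp: perp_def)
  then show ?thesis by (auto simp: mem_perp_set_prod)
qed

lemma lcs_subspace: "subspace (lcs k)"
  by (induction k rule: lcs.induct) (auto simp: set_prod_subspace)

lemma lcs_Suc: "0 < k \<Longrightarrow> lcs (Suc k) = set_prod (lcs k) UNIV"
  by (cases k) auto

lemma mul_lcs: "u \<in> lcs k \<Longrightarrow> 0 < k \<Longrightarrow> mul u v \<in> lcs (Suc k)"
  by (simp add: lcs_Suc set_prod_base)

lemma lcs_Suc_subset: "lcs (Suc k) \<subseteq> lcs k"
proof (induction k rule: lcs.induct)
  case (3 k)
  then show ?case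
    using set_prod_mono [of "lcs (Suc (Suc k))" "lcs (Suc k)" UNIV UNIV] by simp
qed simp_all

lemma lcs_antimono: "i \<le> j \<Longrightarrow> lcs j \<subseteq> lcs i"
  using lift_Suc_antimono_le [of lcs i j] lcs_Suc_subset by blast

text \<open>Both sides say that \<open>triple a b w\<close> vanishes for \<open>a\<close> in
  \<open>lcs i\<close>, \<open>w\<close> in \<open>lcs j\<close> and arbitrary \<open>b\<close>: the
  free factor can be attached to either side of the pairing.\<close>

lemma lcs_orthogonal_shift:
  assumes "0 < i" "0 < j"
  shows "(\<forall>u\<in>lcs (Suc i). \<forall>v\<in>lcs j. form u v = 0) \<longleftrightarrow> (\<forall>u\<in>lcs i. \<forall>v\<in>lcs (Suc j). form u v = 0)"
proof -
  have "(\<forall>u\<in>lcs (Suc i). \<forall>v\<in>lcs j. form u v = 0) \<longleftrightarrow>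
      (\<forall>a\<in>lcs i. \<forall>b. \<forall>w\<in>lcs j. triple a b w = 0)"
    using assms by (simp add: lcs_Suc set_prod_orthogonal)
  also have "\<dots> \<longleftrightarrow> (\<forall>w\<in>lcs j. \<forall>b. \<forall>a\<in>lcs i. triple w b a = 0)"
  proof -
    have *: "triple w b a = 0" if "triple a b w = 0" for a b w
      using that triple_swap12 [of b a w] triple_cyclic [of b a w] by simp
    show ?thesis
      by (intro iffI ballI allI; rule *; simp)
  qed
  also have "\<dots> \<longleftrightarrow> (\<forall>u\<in>lcs (Suc j). \<forall>v\<in>lcs i. form u v = 0)"
    using assms by (simp add: lcs_Suc set_prod_orthogonal)
  also have "\<dots> \<longleftrightarrow> (\<forall>u\<in>lcs (Suc j). \<forall>v\<in>lcs i. form v u = 0)"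
    by (intro ball_cong refl form_eq_0_commute)
  finally show ?thesis by blast
qed

text \<open>By invariance of the form, the pairing of two terms of the lower central series vanishes
  or not depending only on the sum of the indices.\<close>

lemma lcs_orthogonal_iff:
  assumes "0 < i" "0 < j"
  shows "(\<forall>u\<in>lcs i. \<forall>v\<in>lcs j. form u v = 0) \<longleftrightarrow> lcs (i + j - 1) = {0}"
  using assms
proof (induction j arbitrary: i)
  case (Suc j)
  show ?case
  proof (cases "j = 0")
    case True
    have "(\<forall>u\<in>lcs i. \<forall>v. form u v = 0) \<longleftrightarrow> lcs i \<subseteq> {0}"
      using form_nondegenerate form_zero_left by blast
    then show ?thesis
      using True subspace_0 [OF lcs_subspace, of i] by auto
  next
    case False
    then show ?thesis
      using Suc lcs_orthogonal_shift [of i j] by simp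
  qed
qed simp

text \<open>Cyclic symmetry turns (zx, y) into (xy, z), and nondegeneracy lets \<open>y\<close>
  detect whether zx is zero.\<close>

lemma center_eq_perp: "center = perp (lcs 2)"
proof -
  have "z \<in> center \<longleftrightarrow> (\<forall>x y. triple z x y = 0)" for z
    unfolding center_def using form_nondegenerate by (auto simp: form_zero_left)
  also have "\<dots> z \<longleftrightarrow> (\<forall>x y. triple x y z = 0)" for z
    by (simp add: triple_cyclic)
  finally show ?thesis
    using mem_perp_set_prod [of _ UNIV UNIV] by (auto simp: numeral_2_eq_2)
qed

end

subsection \<open>Symplectic frames\<close>

context symplectic_alternating_algebra
begin

text \<open>This replaces computations in one-dimensional quotients V/W: a vector of V is a multiple
  of a fixed representative \<open>c\<close> plus an element of W.\<close>

lemma codim1_decomp: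
  assumes "subspace W" "subspace V" "W \<subseteq> V" "dim V = Suc (dim W)" "c \<in> V" "c \<notin> W" "v \<in> V"
  shows "\<exists>s p. v = smul s c + p \<and> p \<in> W"
proof -
  have "span (insert c W) = V"
  proof (rule fd_subspace_dim_equal)
    show "span (insert c W) \<subseteq> V"
      using assms by (intro span_minimal) auto
    show "dim V \<le> dim (span (insert c W))"
      using assms(1,4,6) by (simp add: fd_dim_insert span_eq_iff [THEN iffD2])
  qed (use assms in auto)
  then obtain s where "v - smul s c \<in> span W"
    using assms(7) span_breakdown_eq by blast
  then have "v - smul s c \<in> W"
    using assms(1) by (simp add: span_eq_iff [THEN iffD2])
  then show ?thesis
    by (intro exI [of _ s] exI [of _ "v - smul s c"]) simp
qed

lemma dim_less_obtain:
  assumes "dim W < dim V"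
  obtains c where "c \<in> V" "c \<notin> W"
  using assms fd_dim_subset [of V W] by force

text \<open>Adding \<open>s\<close> to \<open>S - {s}\<close> raises the dimension of the span and
  so lowers that of the complement. Some vector is therefore orthogonal to the other members but not
  to \<open>s\<close>, and it is rescaled.\<close>

lemma obtain_dual_vector:
  assumes "independent S" "s \<in> S"
  obtains y where "form s y = 1" "\<And>t. t \<in> S \<Longrightarrow> t \<noteq> s \<Longrightarrow> form t y = 0"
proof -
  have fin: "finite S"
    using assms fd_finite_independent by blast
  have "independent (S - {s})"
    using assms independent_mono by blast
  then have "dim (S - {s}) = card S - 1" "dim S = card S" "0 < card S"
    using assms fin by (auto simp: dim_eq_card_independent card_gt_0_iff)
  then have "dim (perp S) < dim (perp (S - {s}))"
    using dim_perp [of S] dim_perp [of "S - {s}"] by linarith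
  then obtain v where v: "v \<in> perp (S - {s})" "v \<notin> perp S"
    by (rule dim_less_obtain)
  then have "form s v \<noteq> 0"
    by (auto simp: perp_def)
  then show thesis
    using v by (intro that [of "smul (1 / form s v) v"]) (auto simp: perp_def form_linear)
qed

lemma form_sum_left: "form (\<Sum>i\<in>A. f i) y = (\<Sum>i\<in>A. form (f i) y)"
  by (induction A rule: infinite_finite_induct) (auto simp: form_linear)

lemma form_sum_right: "form y (\<Sum>i\<in>A. f i) = (\<Sum>i\<in>A. form y (f i))"
  by (induction A rule: infinite_finite_induct) (auto simp: form_linear)

definition symplectic_frame :: "nat \<Rightarrow> (nat \<Rightarrow> 'v) \<Rightarrow> (nat \<Rightarrow> 'v) \<Rightarrow> bool" where
  "symplectic_frame n x y \<longleftrightarrow> (\<forall>i\<in>{1..n}. \<forall>j\<in>{1..n}.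
     form (x i) (x j) = 0 \<and> form (y i) (y j) = 0 \<and> form (x i) (y j) = (if i = j then 1 else 0))"

lemma isotropic_extends_to_frame:
  assumes inj: "inj_on x {1..n}" and ind: "independent (x ` {1..n})"
    and iso: "\<And>i j. i \<in> {1..n} \<Longrightarrow> j \<in> {1..n} \<Longrightarrow> form (x i) (x j) = 0"
  obtains y where "symplectic_frame n x y"
proof -
  have "\<exists>y. \<forall>i\<in>{1..n}. form (x i) y = (if i = j then 1 else 0)" if "j \<in> {1..n}" for j
  proof -
    have "x j \<in> x ` {1..n}"
      using that by blast
    then obtain y where "form (x j) y = 1" "\<And>t. t \<in> x ` {1..n} \<Longrightarrow> t \<noteq> x j \<Longrightarrow> form t y = 0"
      using obtain_dual_vector [OF ind] by metis
    moreover have "x i \<noteq> x j" if "i \<in> {1..n}" "i \<noteq> j" for i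
      using inj that \<open>j \<in> {1..n}\<close> by (meson inj_onD)
    ultimately show ?thesis
      by (intro exI [of _ y]) auto
  qed
  then obtain z where z: "form (x i) (z j) = (if i = j then 1 else 0)"
    if "i \<in> {1..n}" "j \<in> {1..n}" for i j
    by metis
  have z': "form (z j) (x i) = (if i = j then - 1 else 0)"
    if "i \<in> {1..n}" "j \<in> {1..n}" for i j
    using z [OF that] form_skew [of "z j" "x i"] by simp
  \<comment> \<open>Dual vectors \<open>z j\<close> need not be orthogonal to one another. Each
    value (z_i, z_j) with i < j is corrected once, in the vector with the larger index, which avoids
    the factor 1/2 of a symmetric correction.\<close>
  define y where "y j = z j + (\<Sum>i\<in>{1..<j}. smul (form (z i) (z j)) (x i))" for j
  have xy: "form (x i) (y j) = (if i = j then 1 else 0)"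
    if "i \<in> {1..n}" "j \<in> {1..n}" for i j
    using that by (auto simp: y_def form_linear form_sum_right z iso)
  have yy: "form (y j) (y k) = 0" if "j \<in> {1..n}" "k \<in> {1..n}" "j < k" for j k
  proof -
    have "form (y j) (y k) = form (z j) (y k)"
      using that by (simp add: y_def [of j] form_linear form_sum_left xy)
    also have "\<dots> = form (z j) (z k) + (\<Sum>i\<in>{1..<k}. form (z i) (z k) * form (z j) (x i))"
      by (simp add: y_def form_linear form_sum_right)
    also have "(\<Sum>i\<in>{1..<k}. form (z i) (z k) * form (z j) (x i)) =
        (\<Sum>i\<in>{1..<k}. if i = j then - form (z j) (z k) else 0)"
      using that by (intro sum.cong) (auto simp: z')
    also have "\<dots> = - form (z j) (z k)"
      using that by simp
    finally show ?thesis by simp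
  qed
  have "form (y j) (y k) = 0" if "j \<in> {1..n}" "k \<in> {1..n}" for j k
    using yy [of j k] yy [of k j] that form_eq_0_commute [of "y j" "y k"] form_alternating
    by (metis linorder_less_linear)
  then show thesis
    using xy iso by (intro that [of y]) (auto simp: symplectic_frame_def)
qed

text \<open>What remains of the structure constants in a basis that is adapted to the flag
  \<open>L\<^sup>5L\<^sup>2 < L\<^sup>7 < L\<^sup>6 < L\<^sup>5 < U\<close>.\<close>

definition adapted_frame :: "(nat \<Rightarrow> 'v) \<Rightarrow> (nat \<Rightarrow> 'v) \<Rightarrow> bool" where
  "adapted_frame x y \<longleftrightarrow> symplectic_frame 5 x y \<and>
     (\<forall>i\<in>{1..5}. \<forall>j\<in>{1..5}. mul (x i) (x j) = 0) \<and>
     (\<forall>i\<in>{1..5}. \<forall>j\<in>{1..5}. \<forall>k\<in>{1..5}. j < k \<longrightarrow> \<not> (i < j \<and> k = 5) \<longrightarrow>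
        triple (x i) (y j) (y k) = 0) \<and>
     triple (y 1) (y 2) (y 3) = 0 \<and>
     triple (x 3) (y 4) (y 5) \<noteq> 0 \<and> triple (x 2) (y 3) (y 5) \<noteq> 0 \<and>
     triple (x 1) (y 2) (y 5) \<noteq> 0 \<and> triple (y 1) (y 2) (y 4) \<noteq> 0"

end

subsection \<open>The flag of a nilpotent algebra of class 7\<close>

context saa_10_2_3
begin

section \<open>Dimensions in the lower central series, of L^5 L^2 and of U\<close>

lemma lcs_8: "lcs 8 = {0}"
proof -
  have "lcs (nilpotence_class + 1) = {0}"
    unfolding nilpotence_class_def using nilpotent nilpotent_def by (metis (mono_tags, lifting) LeastI)
  then show ?thesis by (simp add: class_eq_7)
qed

lemma lcs_7: "lcs 7 \<noteq> {0}"
  using not_less_Least [of 6 "\<lambda>k. lcs (k + 1) = {0}"] class_eq_7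
  by (simp add: nilpotence_class_def)

lemma lcs_ge_8: "8 \<le> k \<Longrightarrow> lcs k = {0}"
  using lcs_antimono [of 8 k] lcs_8 subspace_0 [OF lcs_subspace, of k] by auto

lemma form_lcs_eq_0:
  assumes "u \<in> lcs i" "v \<in> lcs j" "0 < i" "0 < j" "9 \<le> i + j"
  shows "form u v = 0"
  using lcs_orthogonal_iff [of i j] lcs_ge_8 [of "i + j - 1"] assms by auto

text \<open>In (uv, w) = (vw, u) the factor vw lies one step deeper than v, so the bound 9 for
  orthogonality becomes 8 for products.\<close>

lemma mul_lcs_eq_0:
  assumes "u \<in> lcs i" "v \<in> lcs j" "0 < i" "0 < j" "8 \<le> i + j"
  shows "mul u v = 0"
proof (rule form_nondegenerate, rule allI)
  fix w
  have "form (mul v w) u = 0"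
    using assms mul_lcs by (intro form_lcs_eq_0 [of _ "Suc j" _ i]) auto
  then show "form (mul u v) w = 0"
    by (simp add: triple_cyclic)
qed

text \<open>If two consecutive terms agree, the series is constant from there on, which would
  identify \<open>lcs 7\<close> with \<open>lcs 8\<close>.\<close>

lemma lcs_Suc_neq: "0 < k \<Longrightarrow> k \<le> 7 \<Longrightarrow> lcs (Suc k) \<noteq> lcs k"
proof
  assume k: "0 < k" "k \<le> 7" and eq: "lcs (Suc k) = lcs k"
  have "lcs (k + m) = lcs k" for m
  proof (induction m)
    case (Suc m)
    then have "lcs (Suc (k + m)) = lcs (Suc k)"
      using k by (simp add: lcs_Suc)
    then show ?case using eq by simp
  qed simp
  from this [of "7 - k"] this [of "8 - k"] show False
    using k lcs_7 lcs_8 by simp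
qed

lemma dim_lcs_Suc_less: "0 < k \<Longrightarrow> k \<le> 7 \<Longrightarrow> dim (lcs (Suc k)) < dim (lcs k)"
  using lcs_Suc_neq [of k] lcs_Suc_subset [of k] fd_dim_less [OF lcs_subspace lcs_subspace] by blast

lemma dim_lcs_2: "dim (lcs 2) = 8"
  using dim_perp [of "lcs 2"] center_eq_perp dim_center dim_eq_10 by simp

text \<open>L^7 lies in the center, whence the bound 2. If L^7 were a line, its complement P would
  be a hyperplane. Since L^6 L <= L^7, the triple (uv, w) with w in L^6 vanishes when u or v is in
  P; being alternating in u and v, it vanishes altogether. Then L^2 is orthogonal to L^6, which
  forces L^7 = 0.\<close>

lemma dim_lcs_7: "dim (lcs 7) = 2"
proof -
  have "lcs 7 \<subseteq> perp (lcs 2)"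
    using form_lcs_eq_0 [of _ 2 _ 7] by (auto simp: perp_def)
  then have "dim (lcs 7) \<le> 2"
    using fd_dim_subset center_eq_perp dim_center by metis
  moreover have "dim (lcs 7) \<noteq> 0"
    using lcs_7 subspace_0 [OF lcs_subspace, of 7] by (auto simp: fd_dim_eq_0)
  moreover have "dim (lcs 7) \<noteq> 1"
  proof
    assume "dim (lcs 7) = 1"
    then have dP: "dim UNIV = Suc (dim (perp (lcs 7)))"
      using dim_perp [of "lcs 7"] by simp
    then obtain a where a: "a \<notin> perp (lcs 7)"
      using dim_less_obtain [of "perp (lcs 7)" UNIV] by auto
    have P: "triple p v w = 0" if "p \<in> perp (lcs 7)" "w \<in> lcs 6" for p v w
    proof -
      have "mul w v \<in> lcs 7"
        using mul_lcs [of w 6 v] that by simp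
      then have "triple w v p = 0"
        using that by (auto simp: perp_def)
      then show ?thesis
        by (metis triple_swap12 triple_cyclic neg_equal_0_iff_equal)
    qed
    have "triple u v w = 0" if w: "w \<in> lcs 6" for u v w
    proof -
      obtain s p where u: "u = smul s a + p" "p \<in> perp (lcs 7)"
        using codim1_decomp [OF subspace_perp subspace_UNIV _ dP _ a, of u] by auto
      obtain t q where v: "v = smul t a + q" "q \<in> perp (lcs 7)"
        using codim1_decomp [OF subspace_perp subspace_UNIV _ dP _ a, of v] by auto
      have "triple a q w = 0"
        using P [OF v(2) w, of a] triple_swap12 [of q a w] by simp
      then show ?thesis
        using P [OF u(2) w] unfolding u(1) v(1) by (simp add: form_linear mul_linear triple_eq_0)
    qed
    then have "\<forall>u\<in>lcs 2. \<forall>w\<in>lcs 6. form u w = 0"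
      using set_prod_orthogonal [of UNIV UNIV "lcs 6"] by (simp add: numeral_2_eq_2)
    then show False
      using lcs_orthogonal_iff [of 2 6] lcs_7 by simp
  qed
  ultimately show ?thesis by simp
qed

text \<open>L^4 is orthogonal to L^5, so the form on L^4 depends only on classes modulo L^5. If
  these form a line, L^4 is orthogonal to itself, which forces L^7 = 0.\<close>

lemma dim_lcs_4_neq_5: "\<not> (dim (lcs 4) = 5 \<and> dim (lcs 5) = 4)"
proof
  assume d: "dim (lcs 4) = 5 \<and> dim (lcs 5) = 4"
  then obtain a where a: "a \<in> lcs 4" "a \<notin> lcs 5"
    using dim_less_obtain [of "lcs 5" "lcs 4"] by auto
  have "form u v = 0" if uv: "u \<in> lcs 4" "v \<in> lcs 4" for u v
  proof -
    have dec: "\<exists>s p. u = smul s a + p \<and> p \<in> lcs 5" if "u \<in> lcs 4" for u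
      using codim1_decomp [OF lcs_subspace [of 5] lcs_subspace [of 4] _ _ a that] d
        lcs_antimono [of 4 5] by auto
    obtain s p t q where *: "u = smul s a + p" "p \<in> lcs 5" "v = smul t a + q" "q \<in> lcs 5"
      using dec uv by metis
    show ?thesis
      unfolding *(1,3) using * a form_lcs_eq_0 [of p 5 a 4] form_lcs_eq_0 [of a 4 q 5] form_lcs_eq_0 [of p 5 q 5]
      by (simp add: form_linear form_alternating)
  qed
  then show False
    using lcs_orthogonal_iff [of 4 4] lcs_7 by simp
qed

text \<open>The strict chain between 8 and 2 gives dim L^5 >= 4. With dim L^4 + dim L^5 <= 10 only
  6, 4 and the excluded 5, 4 remain for L^4, L^5; then dim L^3 = 7, and its orthogonality to L^6
  leaves 3.\<close>

lemma dim_lcs: "dim (lcs 3) = 7" "dim (lcs 4) = 6" "dim (lcs 5) = 4" "dim (lcs 6) = 3"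
proof -
  have "dim (lcs 3) + dim (lcs 6) \<le> 10"
    using orthogonal_dim_le [of "lcs 3" "lcs 6"] form_lcs_eq_0 [of _ 3 _ 6] dim_eq_10 by simp
  moreover have "dim (lcs 4) + dim (lcs 5) \<le> 10"
    using orthogonal_dim_le [of "lcs 4" "lcs 5"] form_lcs_eq_0 [of _ 4 _ 5] dim_eq_10 by simp
  moreover have "dim (lcs 3) < dim (lcs 2)" "dim (lcs 4) < dim (lcs 3)" "dim (lcs 5) < dim (lcs 4)"
    "dim (lcs 6) < dim (lcs 5)" "dim (lcs 7) < dim (lcs 6)"
    using dim_lcs_Suc_less [of 2] dim_lcs_Suc_less [of 3] dim_lcs_Suc_less [of 4]
      dim_lcs_Suc_less [of 5] dim_lcs_Suc_less [of 6] by simp_all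
  ultimately show "dim (lcs 3) = 7" "dim (lcs 4) = 6" "dim (lcs 5) = 4" "dim (lcs 6) = 3"
    using dim_lcs_2 dim_lcs_7 dim_lcs_4_neq_5 by linarith+
qed

lemma perp_lcs: "perp (lcs 7) = lcs 2" "perp (lcs 6) = lcs 3" "perp (lcs 5) = lcs 4"
    "perp (lcs 2) = lcs 7"
  using dim_lcs dim_lcs_2 dim_lcs_7 dim_eq_10
    form_lcs_eq_0 [of _ 2 _ 7] form_lcs_eq_0 [of _ 3 _ 6] form_lcs_eq_0 [of _ 4 _ 5] form_lcs_eq_0 [of _ 7 _ 2]
  by (simp_all add: perp_eqI lcs_subspace)

text \<open>L^2 is spanned by a single vector \<open>c\<close> modulo L^3 and cc = 0, so L^2 L^2 <=
  L^4, which is orthogonal to L^5. Hence (uv, w) = (vw, u) = 0 for u in L^5 and v, w in L^2, and the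
  complement of L^2 is L^7.\<close>

lemma L5_L2_subset: "set_prod (lcs 5) (lcs 2) \<subseteq> lcs 7"
proof -
  obtain c where c: "c \<in> lcs 2" "c \<notin> lcs 3"
    using dim_less_obtain [of "lcs 3" "lcs 2"] dim_lcs dim_lcs_2 by auto
  have dec: "\<exists>s p. u = smul s c + p \<and> p \<in> lcs 3" if "u \<in> lcs 2" for u
    using codim1_decomp [OF lcs_subspace [of 3] lcs_subspace [of 2] _ _ c that]
      lcs_antimono [of 2 3] dim_lcs dim_lcs_2 by auto
  have L3: "mul p v \<in> lcs 4" if "p \<in> lcs 3" for p v
    using mul_lcs [of p 3 v] that by simp
  have L2: "mul u v \<in> lcs 4" if uv: "u \<in> lcs 2" "v \<in> lcs 2" for u v
  proof -
    obtain s p t q where *: "u = smul s c + p" "p \<in> lcs 3" "v = smul t c + q" "q \<in> lcs 3"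
      using dec uv by metis
    have "mul c q \<in> lcs 4"
      using L3 [OF *(4), of c] mul_skew [of c q] subspace_neg [OF lcs_subspace] by simp
    moreover have "mul u v = smul s (mul c q) + mul p v"
      unfolding *(1,3) by (simp add: mul_linear mul_alternating)
    ultimately show ?thesis
      using L3 [OF *(2)] by (simp add: subspace_add subspace_scale lcs_subspace)
  qed
  have "mul u v \<in> perp (lcs 2)" if "u \<in> lcs 5" "v \<in> lcs 2" for u v
  proof -
    have "triple v w u = 0" if "w \<in> lcs 2" for w
      using form_lcs_eq_0 [of "mul v w" 4 u 5] L2 that \<open>v \<in> lcs 2\<close> \<open>u \<in> lcs 5\<close> by simp
    then show ?thesis
      using form_eq_0_commute [of _ "mul u v"] by (simp add: perp_def triple_cyclic)
  qed
  then show ?thesis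
    using set_prod_minimal [OF subspace_perp] perp_lcs by metis
qed

text \<open>L^4 L^2 contains L^4 L^3 = L^7. This separates U from L^4, since U L^2 is only a
  line.\<close>

lemma L4_L2: "1 < dim (set_prod (lcs 4) (lcs 2))"
  using fd_dim_subset [OF set_prod_mono [of "lcs 4" "lcs 4" "lcs 3" "lcs 2"]]
    lcs_antimono [of 2 3] L4_L3 dim_lcs_7 by simp

lemma U_neq_L4: "U \<noteq> lcs 4"
  using L4_L2 dim_U_L2 by auto

lemma L4_L3_mem: "x \<in> lcs 4 \<Longrightarrow> a \<in> lcs 3 \<Longrightarrow> mul x a \<in> lcs 7"
  using L4_L3 set_prod_base by metis

text \<open>Otherwise the index in the definition of U is 2, and L^4 L^3 = L^7 makes the condition
  on U hold throughout L^4.\<close>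

lemma L5_L2_nonzero: "set_prod (lcs 5) (lcs 2) \<noteq> {0}"
proof
  assume z: "set_prod (lcs 5) (lcs 2) = {0}"
  have "U_index = 2"
    unfolding U_index_def
  proof (rule Least_equality)
    show "2 \<in> {1::nat, 2, 3} \<and> U_ideal 2 \<inter> set_prod (lcs 4) (lcs 3) \<noteq> {0}"
      using L4_L3 lcs_7 by (simp add: U_ideal_def)
  next
    fix k assume k: "k \<in> {1::nat, 2, 3} \<and> U_ideal k \<inter> set_prod (lcs 4) (lcs 3) \<noteq> {0}"
    have "U_ideal 1 \<inter> set_prod (lcs 4) (lcs 3) = {0}"
      using z subspace_0 [OF set_prod_subspace] by (auto simp: U_ideal_def)
    then have "k \<noteq> 1" using k by blast
    then show "2 \<le> k" using k by auto
  qed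
  then have "U = lcs 4"
    using L4_L3_mem by (auto simp: U_def U_ideal_def)
  then show False using U_neq_L4 by simp
qed

lemma U_eq: "U = {x \<in> lcs 4. \<forall>a\<in>lcs 3. mul x a \<in> set_prod (lcs 5) (lcs 2)}"
proof -
  have "U_index = 1"
    unfolding U_index_def
  proof (rule Least_equality)
    show "1 \<in> {1::nat, 2, 3} \<and> U_ideal 1 \<inter> set_prod (lcs 4) (lcs 3) \<noteq> {0}"
      using L5_L2_nonzero L5_L2_subset L4_L3 by (simp add: U_ideal_def Int_absorb2)
  qed auto
  then show ?thesis
    by (simp add: U_def U_ideal_def)
qed

text \<open>If L^5 L^2 were all of L^7, the condition defining U would again hold throughout
  L^4.\<close>

lemma dim_L5_L2: "dim (set_prod (lcs 5) (lcs 2)) = 1"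
proof -
  have "dim (set_prod (lcs 5) (lcs 2)) \<noteq> 0"
    using L5_L2_nonzero subspace_0 [OF set_prod_subspace] by (auto simp: fd_dim_eq_0)
  moreover have "dim (set_prod (lcs 5) (lcs 2)) < dim (lcs 7)"
  proof (rule fd_dim_less [OF set_prod_subspace lcs_subspace])
    have "set_prod (lcs 5) (lcs 2) \<noteq> lcs 7"
      using U_neq_L4 L4_L3_mem by (auto simp: U_eq)
    then show "set_prod (lcs 5) (lcs 2) \<subset> lcs 7"
      using L5_L2_subset by blast
  qed
  ultimately show ?thesis using dim_lcs_7 by simp
qed

lemma U_subset: "U \<subseteq> lcs 4"
  by (auto simp: U_def)

lemma L5_subset_U: "lcs 5 \<subseteq> U"
  using mul_lcs_eq_0 [of _ 5 _ 3] lcs_antimono [of 4 5] subspace_0 [OF set_prod_subspace]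
  by (auto simp: U_eq)

lemma U_subspace: "subspace U"
  unfolding U_eq
  by (rule subspaceI)
    (auto simp: mul_linear subspace_0 subspace_add subspace_scale lcs_subspace set_prod_subspace)

lemma U_L2: "set_prod U (lcs 2) = set_prod (lcs 5) (lcs 2)"
proof (rule sym, rule fd_subspace_dim_equal [OF set_prod_subspace set_prod_subspace])
  show "set_prod (lcs 5) (lcs 2) \<subseteq> set_prod U (lcs 2)"
    using L5_subset_U by (intro set_prod_mono) auto
qed (simp add: dim_L5_L2 dim_U_L2)

text \<open>Modulo \<open>L\<^sup>5L\<^sup>2\<close>, multiplication by \<open>L\<^sup>3\<close> on \<open>L\<^sup>4\<close> is a single linear functional, because
  \<open>L\<^sup>3/L\<^sup>4\<close> and \<open>L\<^sup>7/L\<^sup>5L\<^sup>2\<close> are one-dimensional.\<close>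

lemma dim_U: "dim U = 5"
proof -
  obtain w where w: "w \<in> lcs 3" "w \<notin> lcs 4"
    using dim_less_obtain [of "lcs 4" "lcs 3"] dim_lcs by auto
  obtain c where c: "c \<in> lcs 7" "c \<notin> set_prod (lcs 5) (lcs 2)"
    using dim_less_obtain [of "set_prod (lcs 5) (lcs 2)" "lcs 7"] dim_L5_L2 dim_lcs_7 by auto
  have dec7: "\<exists>s p. z = smul s c + p \<and> p \<in> set_prod (lcs 5) (lcs 2)" if "z \<in> lcs 7" for z
    using codim1_decomp [OF set_prod_subspace lcs_subspace L5_L2_subset _ c that]
      dim_L5_L2 dim_lcs_7 by auto
  have dec3: "\<exists>s p. z = smul s w + p \<and> p \<in> lcs 4" if "z \<in> lcs 3" for z
    using codim1_decomp [OF lcs_subspace [of 4] lcs_subspace [of 3] _ _ w that]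
      lcs_antimono [of 3 4] dim_lcs by auto
  have "dim (perp (lcs 7)) < dim (perp (set_prod (lcs 5) (lcs 2)))"
    using dim_perp [of "lcs 7"] dim_perp [of "set_prod (lcs 5) (lcs 2)"] dim_L5_L2 dim_lcs_7 by simp
  \<comment> \<open>Pairing with \<open>y\<close> tells whether an element of L^7 lies in L^5
    L^2.\<close>
  then obtain y where y: "y \<in> perp (set_prod (lcs 5) (lcs 2))" "y \<notin> perp (lcs 7)"
    by (rule dim_less_obtain)
  have cy: "form c y \<noteq> 0"
  proof
    assume "form c y = 0"
    then have "form z y = 0" if "z \<in> lcs 7" for z
      using dec7 [OF that] y by (auto simp: form_linear perp_def)
    then show False using y by (auto simp: perp_def)
  qed
  \<comment> \<open>By (xw, y) = (wy, x), an element x of L^4, the complement of L^5, has xw in L^5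
    L^2 as soon as it is orthogonal to the single vector wy. This costs at most one of the six
    dimensions of L^4.\<close>
  have "perp (insert (mul w y) (lcs 5)) \<subseteq> U"
  proof
    fix x assume "x \<in> perp (insert (mul w y) (lcs 5))"
    then have x: "x \<in> lcs 4" and xwy: "triple w y x = 0"
      using perp_lcs by (auto simp: perp_def)
    obtain s p where sp: "mul x w = smul s c + p" "p \<in> set_prod (lcs 5) (lcs 2)"
      using dec7 L4_L3_mem x w by metis
    have "form (mul x w) y = 0"
      using xwy triple_cyclic [of w y x] by simp
    then have "mul x w \<in> set_prod (lcs 5) (lcs 2)"
      using sp cy y by (auto simp: form_linear perp_def)
    moreover have "mul x q = 0" if "q \<in> lcs 4" for q
      using mul_lcs_eq_0 [of x 4 q 4] x that by simp
    ultimately have "mul x a \<in> set_prod (lcs 5) (lcs 2)" if "a \<in> lcs 3" for a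
      using dec3 [OF that] by (auto simp: mul_linear subspace_scale set_prod_subspace)
    then show "x \<in> U" using x by (simp add: U_eq)
  qed
  then have "dim (perp (insert (mul w y) (lcs 5))) \<le> dim U"
    by (rule fd_dim_subset)
  then have "5 \<le> dim U"
    using dim_perp_insert_ge [of "lcs 5" "mul w y"] perp_lcs dim_lcs by simp
  moreover have "dim U < 6"
    using fd_dim_less [OF U_subspace lcs_subspace [of 4]] U_neq_L4 U_subset dim_lcs by auto
  ultimately show ?thesis by simp
qed

section \<open>A symplectic basis adapted to the flag\<close>

lemma exists_adapted_frame: "\<exists>x y. adapted_frame x y"
proof -
  let ?I = "set_prod (lcs 5) (lcs 2)"
  have I5: "{1..5::nat} = {1, 2, 3, 4, 5}" by auto
  have flag: "?I \<subseteq> lcs 7" "lcs 7 \<subseteq> lcs 6" "lcs 6 \<subseteq> lcs 5" "lcs 5 \<subseteq> U" "U \<subseteq> lcs 4"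
    using L5_L2_subset lcs_antimono [of 6 7] lcs_antimono [of 5 6] L5_subset_U U_subset by auto
  have sub: "subspace ?I" "subspace U" "subspace (lcs k)" for k
    by (simp_all add: set_prod_subspace U_subspace lcs_subspace)
  obtain x5 where x5: "x5 \<in> ?I" "x5 \<notin> {0}"
    using L5_L2_nonzero sub(1) subspace_0 by blast
  obtain x4 where x4: "x4 \<in> lcs 7" "x4 \<notin> ?I"
    using dim_less_obtain [of ?I "lcs 7"] dim_L5_L2 dim_lcs_7 by auto
  obtain x3 where x3: "x3 \<in> lcs 6" "x3 \<notin> lcs 7"
    using dim_less_obtain [of "lcs 7" "lcs 6"] dim_lcs dim_lcs_7 by auto
  obtain x2 where x2: "x2 \<in> lcs 5" "x2 \<notin> lcs 6"
    using dim_less_obtain [of "lcs 6" "lcs 5"] dim_lcs by auto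
  obtain x1 where x1: "x1 \<in> U" "x1 \<notin> lcs 5"
    using dim_less_obtain [of "lcs 5" U] dim_lcs dim_U by auto
  define x where "x i = (if i = 1 then x1 else if i = 2 then x2 else if i = 3 then x3
    else if i = 4 then x4 else x5)" for i :: nat
  have x_simps: "x 1 = x1" "x (Suc 0) = x1" "x 2 = x2" "x 3 = x3" "x 4 = x4" "x 5 = x5"
    by (simp_all add: x_def)
  \<comment> \<open>One step up the flag: the dimension grows by one, so any vector of the larger
    space outside the smaller one completes a basis.\<close>
  have up: "independent (insert b S) \<and> card (insert b S) = Suc (card S) \<and> span (insert b S) = V"
    if "independent S \<and> card S = n \<and> span S = W" "subspace V" "W \<subseteq> V" "b \<in> V" "b \<notin> W" "dim V = Suc n"
    for S b V W n
  proof -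
    have ind: "independent (insert b S)"
      using that independent_insertI by blast
    have card: "card (insert b S) = Suc (card S)"
      using that span_base [of b S] ind fd_finite_independent [of S] by (auto simp: card_insert_if)
    have "S \<subseteq> W"
      using that span_superset by blast
    then have "span (insert b S) = V"
      using that ind card by (intro fd_independent_spans) auto
    then show ?thesis using ind card by blast
  qed
  have s0: "independent {} \<and> card {} = 0 \<and> span {} = {0}"
    by (simp add: independent_empty)
  have s5: "independent {x5} \<and> card {x5} = 1 \<and> span {x5} = ?I"
    using up [OF s0 sub(1) _ x5] subspace_0 [OF sub(1)] dim_L5_L2 by simp
  have s4: "independent {x4, x5} \<and> card {x4, x5} = 2 \<and> span {x4, x5} = lcs 7"
    using up [OF s5 sub(3) flag(1) x4] s5 dim_lcs_7 by simp
  have s3: "independent {x3, x4, x5} \<and> card {x3, x4, x5} = 3 \<and> span {x3, x4, x5} = lcs 6"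
    using up [OF s4 sub(3) flag(2) x3] s4 dim_lcs by simp
  have s2: "independent {x2, x3, x4, x5} \<and> card {x2, x3, x4, x5} = 4 \<and> span {x2, x3, x4, x5} = lcs 5"
    using up [OF s3 sub(3) flag(3) x2] s3 dim_lcs by simp
  have s1: "independent {x1, x2, x3, x4, x5} \<and> card {x1, x2, x3, x4, x5} = 5 \<and> span {x1, x2, x3, x4, x5} = U"
    using up [OF s2 sub(2) flag(4) x1] s2 dim_U by simp
  have im: "x ` {1..5} = {x1, x2, x3, x4, x5}"
    unfolding I5 by (auto simp: x_def)
  have iso5: "form u v = 0" if "u \<in> lcs 5" "v \<in> lcs 4" for u v
    using form_lcs_eq_0 [of u 5 v 4] that by simp
  \<comment> \<open>L^5 is orthogonal to L^4 and hence to U, and U is spanned by \<open>x1\<close>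
    modulo L^5, so the alternating form vanishes on U.\<close>
  have isoU: "form u v = 0" if uv: "u \<in> U" "v \<in> U" for u v
  proof -
    have dec: "\<exists>s p. u = smul s x1 + p \<and> p \<in> lcs 5" if "u \<in> U" for u
      using codim1_decomp [OF sub(3) sub(2) flag(4) _ x1 that] dim_lcs dim_U by auto
    obtain s p t q where *: "u = smul s x1 + p" "p \<in> lcs 5" "v = smul t x1 + q" "q \<in> lcs 5"
      using dec uv by metis
    have "form x1 q = 0" "form p x1 = 0" "form p q = 0"
      using iso5 [of q x1] iso5 [of p x1] iso5 [of p q] * x1 flag form_eq_0_commute [of x1 q] by auto
    then show ?thesis
      unfolding *(1,3) by (simp add: form_linear form_alternating)
  qed
  have xU: "x i \<in> U" if "i \<in> {1..5}" for i
    using that s1 im span_superset by blast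
  obtain y where y: "symplectic_frame 5 x y"
  proof (rule isotropic_extends_to_frame)
    show "inj_on x {1..5}"
      using s1 im by (intro eq_card_imp_inj_on) auto
    show "independent (x ` {1..5})"
      using s1 im by simp
    show "form (x i) (x j) = 0" if "i \<in> {1..5}" "j \<in> {1..5}" for i j
      using isoU xU that by blast
  qed
  have xy: "form (x i) (y j) = (if i = j then 1 else 0)" if "i \<in> {1..5}" "j \<in> {1..5}" for i j
    using y that by (simp add: symplectic_frame_def)
  have xy': "form x1 (y j) = (if 1 = j then 1 else 0)" "form x2 (y j) = (if 2 = j then 1 else 0)"
    "form x3 (y j) = (if 3 = j then 1 else 0)" "form x4 (y j) = (if 4 = j then 1 else 0)"
    "form x5 (y j) = (if 5 = j then 1 else 0)" if "j \<in> {1..5}" for j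
    using xy [of 1 j] xy [of 2 j] xy [of 3 j] xy [of 4 j] xy [of 5 j] that by (simp_all add: x_simps)
  \<comment> \<open>\<open>y j\<close> is orthogonal to every \<open>x i\<close> with i > j. For j <
    5 these span a member of the flag, whose complement is already known.\<close>
  have y_mem: "y j \<in> V" if "\<forall>s\<in>S. form s (y j) = 0" "span S = W" "perp W = V" for j S V W
    using that perp_span [of S] by (auto simp: perp_def)
  have y1: "y 1 \<in> lcs 4"
    by (rule y_mem [of "{x2, x3, x4, x5}" 1 "lcs 5" "lcs 4"]) (use s2 perp_lcs in \<open>auto simp: xy'\<close>)
  have y2: "y 2 \<in> lcs 3"
    by (rule y_mem [of "{x3, x4, x5}" 2 "lcs 6" "lcs 3"]) (use s3 perp_lcs in \<open>auto simp: xy'\<close>)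
  have y3: "y 3 \<in> lcs 2"
    by (rule y_mem [of "{x4, x5}" 3 "lcs 7" "lcs 2"]) (use s4 perp_lcs in \<open>auto simp: xy'\<close>)
  have yI: "y j \<in> perp ?I" if "j \<in> {1..4}" for j
    by (rule y_mem [of "{x5}" j ?I]) (use s5 that in \<open>auto simp: xy'\<close>)
  have y4: "y 4 \<in> perp ?I"
    by (rule yI) simp
  have Iy: "form z (y j) = 0" if "z \<in> ?I" "j \<in> {1..4}" for z j
    using yI [OF that(2)] that by (auto simp: perp_def)
  have mul_U_L2: "mul u v \<in> ?I" if "u \<in> U" "v \<in> lcs 2" for u v
    using set_prod_base [OF that] U_L2 by simp
  have mul_UU: "mul u v = 0" if "u \<in> U" "v \<in> lcs 4" for u v
    using that U_subset mul_lcs_eq_0 [of u 4 v 4] by auto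
  have dim_pI: "dim (perp ?I) = 9"
    using dim_perp [of ?I] dim_L5_L2 dim_eq_10 by simp
  have sub23: "lcs 3 \<subseteq> lcs 2" "lcs 4 \<subseteq> lcs 3"
    using lcs_antimono [of 2 3] lcs_antimono [of 3 4] by auto
  have decL2: "\<exists>s p. v = smul s (y 3) + p \<and> p \<in> lcs 3" if "v \<in> lcs 2" for v
  proof (rule codim1_decomp [OF sub(3) sub(3) sub23(1) _ y3 _ that])
    show "y 3 \<notin> lcs 3"
      using form_lcs_eq_0 [of x3 6 "y 3" 3] x3 xy'(3) [of 3] by auto
  qed (use dim_lcs dim_lcs_2 in auto)
  have decL3: "\<exists>s p. v = smul s (y 2) + p \<and> p \<in> lcs 4" if "v \<in> lcs 3" for v
  proof (rule codim1_decomp [OF sub(3) sub(3) sub23(2) _ y2 _ that])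
    show "y 2 \<notin> lcs 4"
      using iso5 [of x2 "y 2"] x2 xy'(2) [of 2] by auto
  qed (use dim_lcs in auto)
  have decL4: "\<exists>s p. v = smul s (y 1) + p \<and> p \<in> U" if "v \<in> lcs 4" for v
  proof (rule codim1_decomp [OF sub(2) sub(3) flag(5) _ y1 _ that])
    show "y 1 \<notin> U"
      using isoU [of x1 "y 1"] x1 xy'(1) [of 1] by auto
  qed (use dim_lcs dim_U in auto)
  have decP: "\<exists>s p. v = smul s (y 4) + p \<and> p \<in> lcs 2" if "v \<in> perp ?I" for v
  proof (rule codim1_decomp [OF sub(3) subspace_perp _ _ y4 _ that])
    show "y 4 \<notin> lcs 2"
      using form_lcs_eq_0 [of x4 7 "y 4" 2] x4 xy'(4) [of 4] by auto
    show "lcs 2 \<subseteq> perp ?I"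
      using flag form_lcs_eq_0 [of _ 7 _ 2] by (auto simp: perp_def)
  qed (use dim_pI dim_lcs_2 in auto)
  have dec: "\<exists>s p. v = smul s (y 5) + p \<and> p \<in> perp ?I" for v
  proof (rule codim1_decomp [OF subspace_perp subspace_UNIV])
    show "y 5 \<notin> perp ?I"
      using x5 xy'(5) [of 5] by (auto simp: perp_def intro!: bexI [of _ x5])
  qed (use dim_pI dim_eq_10 in auto)
  have decU: "\<exists>s p. u = smul s x1 + p \<and> p \<in> lcs 5" if "u \<in> U" for u
    using codim1_decomp [OF sub(3) sub(2) flag(4) _ x1 that] dim_lcs dim_U by auto
  have decL5: "\<exists>s p. u = smul s x2 + p \<and> p \<in> lcs 6" if "u \<in> lcs 5" for u
    using codim1_decomp [OF sub(3) sub(3) flag(3) _ x2 that] dim_lcs by auto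
  have decL6: "\<exists>s p. u = smul s x3 + p \<and> p \<in> lcs 7" if "u \<in> lcs 6" for u
    using codim1_decomp [OF sub(3) sub(3) flag(2) _ x3 that] dim_lcs dim_lcs_7 by auto
  have x7: "mul u v = 0" if "u \<in> lcs 7" for u v
    using mul_lcs_eq_0 [of u 7 v 1] that by simp
  have x6: "mul u v = 0" if "u \<in> lcs 6" "v \<in> lcs 2" for u v
    using mul_lcs_eq_0 [of u 6 v 2] that by simp
  have x5': "mul u v = 0" if "u \<in> lcs 5" "v \<in> lcs 3" for u v
    using mul_lcs_eq_0 [of u 5 v 3] that by simp
  \<comment> \<open>\<open>x3\<close> annihilates L^2, and \<open>y 4\<close>, \<open>y 5\<close>
    span L modulo L^2, so this one triple governs all products with \<open>x3\<close>. If it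
    vanished, L^6, spanned by \<open>x3\<close> modulo the central L^7, would annihilate L, and L^7
    would be 0.\<close>
  have \<alpha>: "triple x3 (y 4) (y 5) \<noteq> 0"
  proof
    assume z: "triple x3 (y 4) (y 5) = 0"
    have z': "triple x3 (y 5) (y 4) = 0"
      using z triple_swap23 [of x3 "y 5" "y 4"] by simp
    have *: "triple x3 v w = t * triple x3 v (y 5) + s * triple x3 v (y 4)"
      if "w = smul t (y 5) + (smul s (y 4) + q)" "q \<in> lcs 2" for v w s t q
      using that x6 [of x3 q] x3 triple_swap23 [of x3 v q] by (simp add: form_linear)
    have "mul x3 v = 0" if v: "v = y 4 \<or> v = y 5" for v
    proof (rule form_nondegenerate, rule allI)
      fix w
      obtain t p where "w = smul t (y 5) + p" "p \<in> perp ?I" using dec by blast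
      then obtain s q where "w = smul t (y 5) + (smul s (y 4) + q)" "q \<in> lcs 2"
        using decP by blast
      then show "triple x3 v w = 0"
        using * [of w t s q v] v z z' by (auto simp: triple_eq_0)
    qed
    then have "mul x3 w = 0" for w
    proof -
      obtain t p where "w = smul t (y 5) + p" "p \<in> perp ?I" using dec by blast
      then obtain s q where "w = smul t (y 5) + (smul s (y 4) + q)" "q \<in> lcs 2"
        using decP by blast
      then show ?thesis
        using x6 [of x3 q] x3 \<open>\<And>v. v = y 4 \<or> v = y 5 \<Longrightarrow> mul x3 v = 0\<close>
        by (simp add: mul_linear)
    qed
    then have "mul u w = 0" if "u \<in> lcs 6" for u w
      using decL6 [OF that] x7 by (auto simp: mul_linear)
    then have "set_prod (lcs 6) UNIV \<subseteq> {0}"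
      by (intro set_prod_minimal) auto
    then show False
      using lcs_7 lcs_Suc [of 6] subspace_0 [OF sub(3) [of 7]] by auto
  qed
  \<comment> \<open>Since L^6 L^2 = L^5 L^3 = 0, the space L^5 L^2 is spanned by the product of
    \<open>x2\<close> and \<open>y 3\<close>, whose coefficient at \<open>x5\<close> is this
    triple.\<close>
  have \<beta>: "triple x2 (y 3) (y 5) \<noteq> 0"
  proof
    assume z: "triple x2 (y 3) (y 5) = 0"
    have "mul x2 (y 3) \<in> ?I"
      using set_prod_base x2 y3 by blast
    then obtain c where c: "mul x2 (y 3) = smul c x5"
      using s5 span_singleton [of x5] by auto
    then have "c = 0"
      using z xy'(5) [of 5] by (simp add: form_linear)
    then have x2y3: "mul x2 (y 3) = 0"
      using c by simp
    have "mul u v = 0" if uv: "u \<in> lcs 5" "v \<in> lcs 2" for u v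
    proof -
      obtain s p t q where *: "u = smul s x2 + p" "p \<in> lcs 6" "v = smul t (y 3) + q" "q \<in> lcs 3"
        using decL5 [OF uv(1)] decL2 [OF uv(2)] by blast
      have "mul p q = 0" "mul p (y 3) = 0" "mul x2 q = 0"
        using x6 [of p q] x6 [of p "y 3"] x5' [of x2 q] * x2 y3 sub23 by auto
      then show ?thesis
        unfolding *(1,3) by (simp add: mul_linear x2y3)
    qed
    then have "?I \<subseteq> {0}"
      by (intro set_prod_minimal) auto
    then show False
      using L5_L2_nonzero subspace_0 [OF sub(1)] by auto
  qed
  \<comment> \<open>L^4 is spanned by \<open>y 1\<close> and \<open>x1\<close> modulo L^5, and L^3
    by \<open>y 2\<close> modulo L^4. As L^5 L^3 = L^4 L^4 = 0, the products of \<open>y 1\<close>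
    and of \<open>x1\<close> with \<open>y 2\<close> span L^4 L^3 = L^7.\<close>
  have triple43: "triple a b w = s * t * triple (y 1) (y 2) w + t * r * triple x1 (y 2) w"
    if "a = smul s (y 1) + (smul r x1 + p)" "p \<in> lcs 5" "b = smul t (y 2) + q" "q \<in> lcs 4"
    for a b w s t r p q
  proof -
    have "mul (y 1) q = 0" "mul x1 q = 0" "mul p (y 2) = 0" "mul p q = 0"
      using mul_lcs_eq_0 [of "y 1" 4 q 4] mul_UU [of x1 q] x5' [of p "y 2"] x5' [of p q]
        that y1 y2 x1 sub23 by auto
    then show ?thesis
      unfolding that(1,3) by (simp add: mul_linear form_linear algebra_simps)
  qed
  have L7_form: "form z w = 0"
    if w: "triple (y 1) (y 2) w = 0" "triple x1 (y 2) w = 0" and z: "z \<in> lcs 7" for w z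
  proof -
    have "triple a b w = 0" if ab: "a \<in> lcs 4" "b \<in> lcs 3" for a b
    proof -
      obtain s p' t q where *: "a = smul s (y 1) + p'" "p' \<in> U" "b = smul t (y 2) + q" "q \<in> lcs 4"
        using decL4 [OF ab(1)] decL3 [OF ab(2)] by blast
      obtain r p where "p' = smul r x1 + p" "p \<in> lcs 5"
        using decU * by blast
      then show ?thesis
        using * triple43 [of a s r p b t q w] w by simp
    qed
    then have "w \<in> perp (set_prod (lcs 4) (lcs 3))"
      by (simp add: mem_perp_set_prod)
    then show ?thesis
      using z L4_L3 by (simp add: perp_def)
  qed
  have x1y2: "mul x1 (y 2) \<in> ?I"
    using mul_U_L2 x1 y2 sub23 by blast
  have x1y24: "triple x1 (y 2) (y 4) = 0"
    using Iy [OF x1y2] by simp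
  \<comment> \<open>\<open>y 4\<close> is orthogonal to the second of these products, which lies in
    L^5 L^2, but not to \<open>x4\<close> in L^7; so it cannot be orthogonal to the first.\<close>
  have \<eta>: "triple (y 1) (y 2) (y 4) \<noteq> 0"
    using L7_form [of "y 4" x4] x1y24 x4 xy'(4) [of 4] by auto
  have \<delta>: "triple x1 (y 2) (y 5) \<noteq> 0"
  proof
    assume z: "triple x1 (y 2) (y 5) = 0"
    \<comment> \<open>The combination of \<open>y 4\<close> and \<open>y 5\<close> orthogonal to the
      product of \<open>y 1\<close> and \<open>y 2\<close>. If the triple in question vanished,
      \<open>w\<close> would be orthogonal to all of L^7, yet its pairing with \<open>x5\<close> is
      the nonzero (y_1 y_2, y_4).\<close>
    define w where "w = smul (triple (y 1) (y 2) (y 4)) (y 5) - smul (triple (y 1) (y 2) (y 5)) (y 4)"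
    have "triple (y 1) (y 2) w = 0"
      by (simp add: w_def form_linear)
    moreover have "triple x1 (y 2) w = 0"
      using z x1y24 by (simp add: w_def form_linear)
    moreover have "x5 \<in> lcs 7"
      using x5 flag by blast
    ultimately have "form x5 w = 0"
      by (rule L7_form)
    then show False
      using \<eta> xy'(5) [of 4] xy'(5) [of 5] by (simp add: w_def form_linear)
  qed
  have y123: "triple (y 1) (y 2) (y 3) = 0"
    using form_lcs_eq_0 [of "mul (y 1) (y 2)" 7 "y 3" 2] L4_L3_mem y1 y2 y3 by simp
  have zero: "triple (x i) (y j) (y k) = 0"
    if ijk: "i \<in> {1..5}" "j \<in> {1..5}" "k \<in> {1..5}" "j < k" "\<not> (i < j \<and> k = 5)" for i j k
  proof -
    \<comment> \<open>The cases follow the depth of the factors: x_4 and x_5 are central, x_3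
      annihilates L^2, x_2 annihilates L^3, x_1 annihilates L^4. The remaining products x_2 y_3, x_1
      y_2, x_1 y_3 lie in L^5 L^2, to which y_1, ..., y_4 are orthogonal.\<close>
    have "i = 4 \<or> i = 5 \<or> i = 3 \<and> j \<le> 3 \<or> i = 2 \<and> j \<le> 2 \<or> i = 2 \<and> j = 3 \<and> k = 4
      \<or> i = 1 \<and> j = 1 \<or> i = 1 \<and> (j = 2 \<or> j = 3) \<and> k \<le> 4"
      using ijk unfolding atLeastAtMost_iff by presburger
    then consider "i = 4 \<or> i = 5" | "i = 3" "j \<le> 3" | "i = 2" "j \<le> 2" | "i = 2" "j = 3" "k = 4"
      | "i = 1" "j = 1" | "i = 1" "j = 2 \<or> j = 3" "k \<le> 4"
      by blast
    then show ?thesis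
    proof cases
      case 1
      then show ?thesis
        using x7 [of "x i"] x4 x5 flag by (auto simp: x_simps form_linear)
    next
      case 2
      then have "y j \<in> lcs 2"
        using ijk y1 y2 y3 sub23 unfolding I5 by auto
      then show ?thesis
        using x6 x3 2 by (simp add: x_simps form_linear)
    next
      case 3
      then have "y j \<in> lcs 3"
        using ijk y1 y2 sub23 unfolding I5 by auto
      then show ?thesis
        using x5' x2 3 by (simp add: x_simps form_linear)
    next
      case 4
      have "mul x2 (y 3) \<in> ?I"
        using set_prod_base x2 y3 by blast
      then show ?thesis
        using Iy 4 by (simp add: x_simps)
    next
      case 5
      then show ?thesis
        using mul_UU x1 y1 by (simp add: x_simps form_linear)
    next
      case 6
      then have "mul x1 (y j) \<in> ?I"
        using mul_U_L2 x1 y2 y3 sub23 by auto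
      then show ?thesis
        using Iy 6 ijk by (simp add: x_simps)
    qed
  qed
  have "mul (x i) (x j) = 0" if "i \<in> {1..5}" "j \<in> {1..5}" for i j
    using mul_UU xU that U_subset by blast
  then show ?thesis
    using y zero y123 \<alpha> \<beta> \<delta> \<eta> x_simps by (intro exI [of _ x] exI [of _ y]) (simp add: adapted_frame_def)
qed

end

subsection \<open>Normalisation of the triples\<close>

lemma ball_1_5: "(\<forall>i\<in>{1..5::nat}. P i) \<longleftrightarrow> P 1 \<and> P 2 \<and> P 3 \<and> P 4 \<and> P 5"
proof -
  have "{1..5::nat} = {1, 2, 3, 4, 5}" by auto
  then show ?thesis by simp
qed

lemma less_triples_1_5:
  "(\<forall>i\<in>{1..5::nat}. \<forall>j\<in>{1..5::nat}. \<forall>k\<in>{1..5}. j < k \<longrightarrow> \<not> (i < j \<and> k = 5) \<longrightarrow> P i j k) \<longleftrightarrow>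
   (\<forall>i\<in>{1..5}. P i 1 2 \<and> P i 1 3 \<and> P i 1 4 \<and> P i 1 5 \<and> P i 2 3 \<and> P i 2 4 \<and> P i 3 4) \<and>
   (P 2 2 5 \<and> P 3 2 5 \<and> P 4 2 5 \<and> P 5 2 5) \<and> (P 3 3 5 \<and> P 4 3 5 \<and> P 5 3 5) \<and> P 4 4 5 \<and> P 5 4 5"
  unfolding ball_1_5 by simp blast

locale adapted_saa = symplectic_alternating_algebra +
  fixes x y :: "nat \<Rightarrow> 'b"
  assumes frame: "adapted_frame x y"
begin

lemma form_xx: "\<lbrakk>i \<in> {1..5}; j \<in> {1..5}\<rbrakk> \<Longrightarrow> form (x i) (x j) = 0"
  and form_yy: "\<lbrakk>i \<in> {1..5}; j \<in> {1..5}\<rbrakk> \<Longrightarrow> form (y i) (y j) = 0"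
  and form_xy: "\<lbrakk>i \<in> {1..5}; j \<in> {1..5}\<rbrakk> \<Longrightarrow> form (x i) (y j) = (if i = j then 1 else 0)"
  and mul_xx: "\<lbrakk>i \<in> {1..5}; j \<in> {1..5}\<rbrakk> \<Longrightarrow> mul (x i) (x j) = 0"
  using frame unfolding adapted_frame_def symplectic_frame_def by blast+

lemma form_yx: "\<lbrakk>i \<in> {1..5}; j \<in> {1..5}\<rbrakk> \<Longrightarrow> form (y j) (x i) = (if i = j then - 1 else 0)"
  using form_xy form_skew [of "y j" "x i"] by simp

lemma triple_xyy_eq_0:
  "\<lbrakk>i \<in> {1..5}; j \<in> {1..5}; k \<in> {1..5}; j < k; \<not> (i < j \<and> k = 5)\<rbrakk> \<Longrightarrow> triple (x i) (y j) (y k) = 0"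
  using frame unfolding adapted_frame_def by blast

lemma triple_y123: "triple (y 1) (y 2) (y 3) = 0"
  using frame unfolding adapted_frame_def by blast

lemma triple_nonzero:
  "triple (x 3) (y 4) (y 5) \<noteq> 0" "triple (x 2) (y 3) (y 5) \<noteq> 0"
  "triple (x 1) (y 2) (y 5) \<noteq> 0" "triple (y 1) (y 2) (y 4) \<noteq> 0"
  using frame unfolding adapted_frame_def by blast+

lemma triple_yxw: "triple (y i) (x j) w = - triple (x j) (y i) w"
  by (rule triple_swap12)

lemma triple_yyx: "triple (y i) (y j) (x k) = triple (x k) (y i) (y j)"
  by (rule triple_cyclic)

lemma triple_xyx: "\<lbrakk>i \<in> {1..5}; k \<in> {1..5}\<rbrakk> \<Longrightarrow> triple (x i) w (x k) = 0"
  using triple_cyclic [of "x i" w "x k"] by (simp only: mul_xx form_zero_left)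

lemma triple_y_swap12: "j < i \<Longrightarrow> triple (y i) (y j) w = - triple (y j) (y i) w"
  by (rule triple_swap12)

lemma triple_y_swap23: "k < j \<Longrightarrow> triple u (y j) (y k) = - triple u (y k) (y j)"
  by (rule triple_swap23)

text \<open>As rewrite rules these sort a triple of frame vectors, x before y and the indices of the
  y increasing; the swaps of two y are conditional on the order of their indices.
  \<open>triple_y123\<close> is taken with \<open>Suc 0\<close> because simplification brings the
  index 1 into that form.\<close>

lemmas frame_simps = form_xx form_yy form_xy form_yx mul_xx triple_xyy_eq_0 triple_y123 [unfolded One_nat_def]
  triple_yxw triple_yyx triple_xyx triple_y_swap12 triple_y_swap23 triple_eq_0
  form_linear mul_linear

end

context symplectic_alternating_algebra
begin

lemmas adapted_frame_unrolled =
  adapted_frame_def [unfolded symplectic_frame_def less_triples_1_5, unfolded ball_1_5]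

text \<open>The pivot is (y_1 y_2, y_4): adding multiples of y_2 and y_1 to y_3 shifts the two
  unwanted triples by multiples of it. The changes of x_2 and x_1 restore their orthogonality to the
  new y_3.\<close>

lemma adapted_frame_clear_yyy4:
  assumes "adapted_frame x y"
  shows "\<exists>x' y'. adapted_frame x' y' \<and> triple (y' 1) (y' 3) (y' 4) = 0 \<and> triple (y' 2) (y' 3) (y' 4) = 0"
proof -
  interpret adapted_saa smul form mul x y
    using assms by unfold_locales
  define m where "m = - triple (y 1) (y 3) (y 4) / triple (y 1) (y 2) (y 4)"
  define q where "q = triple (y 2) (y 3) (y 4) / triple (y 1) (y 2) (y 4)"
  have m: "m * triple (y 1) (y 2) (y 4) = - triple (y 1) (y 3) (y 4)"
    and q: "q * triple (y 1) (y 2) (y 4) = triple (y 2) (y 3) (y 4)"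
    using triple_nonzero by (simp_all add: m_def q_def)
  define y' where "y' = y(3 := y 3 + smul m (y 2) + smul q (y 1))"
  define x' where "x' = x(2 := x 2 - smul m (x 3), 1 := x 1 - smul q (x 3))"
  have "adapted_frame x' y' \<and> triple (y' 1) (y' 3) (y' 4) = 0 \<and> triple (y' 2) (y' 3) (y' 4) = 0"
    unfolding adapted_frame_unrolled using triple_nonzero m q
    by (simp add: x'_def y'_def frame_simps)
  then show ?thesis by blast
qed

text \<open>The pivot is (x_2 y_3, y_5), brought in by changing x_1 by a multiple of x_2. The
  compensating multiple of y_1 in y_2 does no harm to (y_2 y_3, y_4) because (y_1 y_3, y_4) is
  already zero.\<close>

lemma adapted_frame_clear_x1y3y5:
  assumes "adapted_frame x y"
    and y3: "triple (y 1) (y 3) (y 4) = 0" "triple (y 2) (y 3) (y 4) = 0"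
  shows "\<exists>x' y'. adapted_frame x' y' \<and> triple (y' 1) (y' 3) (y' 4) = 0 \<and> triple (y' 2) (y' 3) (y' 4) = 0 \<and>
    triple (x' 1) (y' 3) (y' 5) = 0"
proof -
  interpret adapted_saa smul form mul x y
    using assms by unfold_locales
  define n where "n = triple (x 1) (y 3) (y 5) / triple (x 2) (y 3) (y 5)"
  have n: "n * triple (x 2) (y 3) (y 5) = triple (x 1) (y 3) (y 5)"
    using triple_nonzero by (simp add: n_def)
  define y' where "y' = y(2 := y 2 + smul n (y 1))"
  define x' where "x' = x(1 := x 1 - smul n (x 2))"
  have "adapted_frame x' y' \<and> triple (y' 1) (y' 3) (y' 4) = 0 \<and> triple (y' 2) (y' 3) (y' 4) = 0 \<and>
      triple (x' 1) (y' 3) (y' 5) = 0"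
    unfolding adapted_frame_unrolled using triple_nonzero n y3
    by (simp add: x'_def y'_def frame_simps)
  then show ?thesis by blast
qed

text \<open>The pivots are (x_2 y_3, y_5) and (x_1 y_2, y_5), brought in by adding multiples of y_3
  and y_2 to y_4. They do not interact, because (x_1 y_3, y_5) has been cleared and (x_2 y_2, y_5) =
  0; the earlier zeros persist because (y_1 y_2, y_3) = 0.\<close>

lemma adapted_frame_clear_xy4y5:
  assumes "adapted_frame x y"
    and y3: "triple (y 1) (y 3) (y 4) = 0" "triple (y 2) (y 3) (y 4) = 0" "triple (x 1) (y 3) (y 5) = 0"
  shows "\<exists>x' y'. adapted_frame x' y' \<and> triple (y' 1) (y' 3) (y' 4) = 0 \<and> triple (y' 2) (y' 3) (y' 4) = 0 \<and>
    triple (x' 1) (y' 3) (y' 5) = 0 \<and> triple (x' 1) (y' 4) (y' 5) = 0 \<and> triple (x' 2) (y' 4) (y' 5) = 0"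
proof -
  interpret adapted_saa smul form mul x y
    using assms by unfold_locales
  define k where "k = - triple (x 2) (y 4) (y 5) / triple (x 2) (y 3) (y 5)"
  define l where "l = - triple (x 1) (y 4) (y 5) / triple (x 1) (y 2) (y 5)"
  have k: "k * triple (x 2) (y 3) (y 5) = - triple (x 2) (y 4) (y 5)"
    and l: "l * triple (x 1) (y 2) (y 5) = - triple (x 1) (y 4) (y 5)"
    using triple_nonzero by (simp_all add: k_def l_def)
  define y' where "y' = y(4 := y 4 + smul k (y 3) + smul l (y 2))"
  define x' where "x' = x(3 := x 3 - smul k (x 4), 2 := x 2 - smul l (x 4))"
  have "adapted_frame x' y' \<and> triple (y' 1) (y' 3) (y' 4) = 0 \<and> triple (y' 2) (y' 3) (y' 4) = 0 \<and>
      triple (x' 1) (y' 3) (y' 5) = 0 \<and> triple (x' 1) (y' 4) (y' 5) = 0 \<and> triple (x' 2) (y' 4) (y' 5) = 0"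
    unfolding adapted_frame_unrolled using triple_nonzero k l y3
    by (simp add: x'_def y'_def frame_simps)
  then show ?thesis by blast
qed

text \<open>The x_i stay fixed, and y_1, y_2, y_3 receive combinations of x_1, x_2, x_3 with a
  symmetric coefficient matrix, which keeps them mutually orthogonal. Triples without y_5 do not
  change, and the six entries of the matrix match the six triples to be cleared.\<close>

lemma adapted_frame_clear_yyy5:
  assumes "adapted_frame x y"
    and z: "triple (y 1) (y 3) (y 4) = 0" "triple (y 2) (y 3) (y 4) = 0" "triple (x 1) (y 3) (y 5) = 0"
      "triple (x 1) (y 4) (y 5) = 0" "triple (x 2) (y 4) (y 5) = 0"
  shows "\<exists>x' y'. adapted_frame x' y' \<and> triple (y' 1) (y' 3) (y' 4) = 0 \<and> triple (y' 2) (y' 3) (y' 4) = 0 \<and>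
    triple (x' 1) (y' 3) (y' 5) = 0 \<and> triple (x' 1) (y' 4) (y' 5) = 0 \<and> triple (x' 2) (y' 4) (y' 5) = 0 \<and>
    triple (y' 1) (y' 2) (y' 5) = 0 \<and> triple (y' 1) (y' 3) (y' 5) = 0 \<and> triple (y' 1) (y' 4) (y' 5) = 0 \<and>
    triple (y' 2) (y' 3) (y' 5) = 0 \<and> triple (y' 2) (y' 4) (y' 5) = 0 \<and> triple (y' 3) (y' 4) (y' 5) = 0"
proof -
  interpret adapted_saa smul form mul x y
    using assms by unfold_locales
  define \<alpha> where "\<alpha> = triple (x 3) (y 4) (y 5)"
  define \<beta> where "\<beta> = triple (x 2) (y 3) (y 5)"
  define \<delta> where "\<delta> = triple (x 1) (y 2) (y 5)"
  have nz: "\<alpha> \<noteq> 0" "\<beta> \<noteq> 0" "\<delta> \<noteq> 0"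
    using triple_nonzero by (simp_all add: \<alpha>_def \<beta>_def \<delta>_def)
  define s11 where "s11 = - triple (y 1) (y 2) (y 5) / \<delta>"
  define s12 where "s12 = - triple (y 1) (y 3) (y 5) / \<beta>"
  define s13 where "s13 = - triple (y 1) (y 4) (y 5) / \<alpha>"
  \<comment> \<open>\<open>s13\<close> also occurs as the coefficient of x_1 in the new y_3 and so
    enters (y_2 y_3, y_5) through (x_1 y_2, y_5). Each of the other five equations has a single
    unknown.\<close>
  define s22 where "s22 = (s13 * \<delta> - triple (y 2) (y 3) (y 5)) / \<beta>"
  define s23 where "s23 = - triple (y 2) (y 4) (y 5) / \<alpha>"
  define s33 where "s33 = - triple (y 3) (y 4) (y 5) / \<alpha>"
  have s: "s11 * triple (x 1) (y 2) (y 5) = - triple (y 1) (y 2) (y 5)"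
    "s12 * triple (x 2) (y 3) (y 5) = - triple (y 1) (y 3) (y 5)"
    "s13 * triple (x 3) (y 4) (y 5) = - triple (y 1) (y 4) (y 5)"
    "s22 * triple (x 2) (y 3) (y 5) = s13 * triple (x 1) (y 2) (y 5) - triple (y 2) (y 3) (y 5)"
    "s23 * triple (x 3) (y 4) (y 5) = - triple (y 2) (y 4) (y 5)"
    "s33 * triple (x 3) (y 4) (y 5) = - triple (y 3) (y 4) (y 5)"
    unfolding \<alpha>_def [symmetric] \<beta>_def [symmetric] \<delta>_def [symmetric] using nz
    by (simp_all add: s11_def s12_def s13_def s22_def s23_def s33_def)
  define y' where "y' = y(1 := y 1 + smul s11 (x 1) + smul s12 (x 2) + smul s13 (x 3),
    2 := y 2 + smul s12 (x 1) + smul s22 (x 2) + smul s23 (x 3),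
    3 := y 3 + smul s13 (x 1) + smul s23 (x 2) + smul s33 (x 3))"
  have "adapted_frame x y' \<and> triple (y' 1) (y' 3) (y' 4) = 0 \<and> triple (y' 2) (y' 3) (y' 4) = 0 \<and>
    triple (x 1) (y' 3) (y' 5) = 0 \<and> triple (x 1) (y' 4) (y' 5) = 0 \<and> triple (x 2) (y' 4) (y' 5) = 0 \<and>
    triple (y' 1) (y' 2) (y' 5) = 0 \<and> triple (y' 1) (y' 3) (y' 5) = 0 \<and> triple (y' 1) (y' 4) (y' 5) = 0 \<and>
    triple (y' 2) (y' 3) (y' 5) = 0 \<and> triple (y' 2) (y' 4) (y' 5) = 0 \<and> triple (y' 3) (y' 4) (y' 5) = 0"
    unfolding adapted_frame_unrolled using triple_nonzero z s
    by (simp add: y'_def frame_simps)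
  then show ?thesis by blast
qed

text \<open>The condition on j and k encodes the first three entries of the presentation at once:
  together with j < k it restricts i to 1, 2, 3.\<close>

definition normal_frame :: "(nat \<Rightarrow> 'v) \<Rightarrow> (nat \<Rightarrow> 'v) \<Rightarrow> bool" where
  "normal_frame x y \<longleftrightarrow> symplectic_frame 5 x y \<and>
     (\<forall>i\<in>{1..5}. \<forall>j\<in>{1..5}. mul (x i) (x j) = 0) \<and>
     (\<forall>i\<in>{1..5}. \<forall>j\<in>{1..5}. \<forall>k\<in>{1..5}. j < k \<longrightarrow>
        triple (x i) (y j) (y k) = (if j = i + 1 \<and> k = 5 then 1 else 0)) \<and>
     (\<forall>i\<in>{1..5}. \<forall>j\<in>{1..5}. \<forall>k\<in>{1..5}. i < j \<longrightarrow> j < k \<longrightarrow>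
        triple (y i) (y j) (y k) = (if i = 1 \<and> j = 2 \<and> k = 4 then 1 else 0))"

lemma exists_normal_frame:
  assumes "adapted_frame x\<^sub>0 y\<^sub>0"
  shows "\<exists>x y. normal_frame x y"
proof -
  obtain x1 y1 where 1: "adapted_frame x1 y1" "triple (y1 1) (y1 3) (y1 4) = 0"
      "triple (y1 2) (y1 3) (y1 4) = 0"
    using adapted_frame_clear_yyy4 [OF assms] by blast
  obtain x2 y2 where 2: "adapted_frame x2 y2" "triple (y2 1) (y2 3) (y2 4) = 0"
      "triple (y2 2) (y2 3) (y2 4) = 0" "triple (x2 1) (y2 3) (y2 5) = 0"
    using adapted_frame_clear_x1y3y5 [OF 1] by blast
  obtain x3 y3 where 3: "adapted_frame x3 y3" "triple (y3 1) (y3 3) (y3 4) = 0"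
      "triple (y3 2) (y3 3) (y3 4) = 0" "triple (x3 1) (y3 3) (y3 5) = 0"
      "triple (x3 1) (y3 4) (y3 5) = 0" "triple (x3 2) (y3 4) (y3 5) = 0"
    using adapted_frame_clear_xy4y5 [OF 2] by blast
  obtain x y where "adapted_frame x y" and
    z: "triple (y 1) (y 3) (y 4) = 0" "triple (y 2) (y 3) (y 4) = 0"
    "triple (x 1) (y 3) (y 5) = 0" "triple (x 1) (y 4) (y 5) = 0" "triple (x 2) (y 4) (y 5) = 0"
    "triple (y 1) (y 2) (y 5) = 0" "triple (y 1) (y 3) (y 5) = 0" "triple (y 1) (y 4) (y 5) = 0"
    "triple (y 2) (y 3) (y 5) = 0" "triple (y 2) (y 4) (y 5) = 0" "triple (y 3) (y 4) (y 5) = 0"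
    using adapted_frame_clear_yyy5 [OF 3] by blast
  then interpret adapted_saa smul form mul x y
    by unfold_locales
  define \<alpha> where "\<alpha> = triple (x 3) (y 4) (y 5)"
  define \<beta> where "\<beta> = triple (x 2) (y 3) (y 5)"
  define \<delta> where "\<delta> = triple (x 1) (y 2) (y 5)"
  define \<eta> where "\<eta> = triple (y 1) (y 2) (y 4)"
  have nz: "\<alpha> \<noteq> 0" "\<beta> \<noteq> 0" "\<delta> \<noteq> 0" "\<eta> \<noteq> 0"
    using triple_nonzero by (simp_all add: \<alpha>_def \<beta>_def \<delta>_def \<eta>_def)
  \<comment> \<open>Scaling x_i by t_i and y_i by 1/t_i leaves four equations for five factors. The
    spare freedom is spent on t_3 t_5 = 1; with t_3 = \<open>c\<close> the first three equations
    determine t_4, t_2, t_1, and the last becomes linear in \<open>c\<close>. Hence no roots are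
    required.\<close>
  define c where "c = \<eta> * \<beta> * \<beta> * \<delta> / \<alpha>"
  define t where "t i = (if i = 1 then 1 / (c * \<beta> * \<delta>) else if i = 2 then 1 / \<beta> else if i = 3 then c
    else if i = 4 then \<alpha> * c * c else 1 / c)" for i :: nat
  have c0: "c \<noteq> 0" using nz by (simp add: c_def)
  have t0: "t i \<noteq> 0" for i using nz c0 by (simp add: t_def)
  have t: "\<alpha> * t 3 = t 4 * t 5" "\<beta> * t 2 = t 3 * t 5" "\<delta> * t 1 = t 2 * t 5" "\<eta> = t 1 * t 2 * t 4"
    using nz c0 by (simp_all add: t_def field_simps) (simp add: c_def)
  have xyy: "triple (x i) (y j) (y k) = 0"
    if "i \<in> {1..5}" "j \<in> {1..5}" "k \<in> {1..5}" "j < k" "\<not> (j = i + 1 \<and> k = 5)" for i j k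
  proof (cases "i < j \<and> k = 5")
    case True
    then have "i = 1 \<and> j = 3 \<or> i = 1 \<and> j = 4 \<or> i = 2 \<and> j = 4"
      using that unfolding atLeastAtMost_iff by presburger
    then show ?thesis
      using True z by auto
  qed (use that triple_xyy_eq_0 in auto)
  have yyy: "triple (y i) (y j) (y k) = 0"
    if "i \<in> {1..5}" "j \<in> {1..5}" "k \<in> {1..5}" "i < j" "j < k" "\<not> (i = 1 \<and> j = 2 \<and> k = 4)" for i j k
  proof -
    have "i = 1 \<and> j = 2 \<and> k = 3 \<or> i = 1 \<and> j = 2 \<and> k = 5 \<or> i = 1 \<and> j = 3 \<and> k = 4 \<or>
        i = 1 \<and> j = 3 \<and> k = 5 \<or> i = 1 \<and> j = 4 \<and> k = 5 \<or> i = 2 \<and> j = 3 \<and> k = 4 \<or>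
        i = 2 \<and> j = 3 \<and> k = 5 \<or> i = 2 \<and> j = 4 \<and> k = 5 \<or> i = 3 \<and> j = 4 \<and> k = 5"
      using that unfolding atLeastAtMost_iff by presburger
    then show ?thesis
      using z triple_y123 by (elim disjE) simp_all
  qed
  define x' where "x' i = smul (t i) (x i)" for i
  define y' where "y' i = smul (1 / t i) (y i)" for i
  have "symplectic_frame 5 x' y'"
    unfolding symplectic_frame_def
    by (auto simp: x'_def y'_def form_linear t0 form_xx form_yy form_xy)
  moreover have "\<forall>i\<in>{1..5}. \<forall>j\<in>{1..5}. mul (x' i) (x' j) = 0"
    by (auto simp: x'_def mul_linear mul_xx)
  moreover have "triple (x' i) (y' j) (y' k) = (if j = i + 1 \<and> k = 5 then 1 else 0)"
    if "i \<in> {1..5}" "j \<in> {1..5}" "k \<in> {1..5}" "j < k" for i j k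
  proof (cases "j = i + 1 \<and> k = 5")
    case True
    then have "i = 1 \<and> j = 2 \<or> i = 2 \<and> j = 3 \<or> i = 3 \<and> j = 4"
      using that unfolding atLeastAtMost_iff by presburger
    then show ?thesis
      using True t t0 unfolding x'_def y'_def \<alpha>_def \<beta>_def \<delta>_def
      by (elim disjE) (simp_all add: form_linear mul_linear field_simps)
  qed (use that xyy in \<open>auto simp: x'_def y'_def form_linear mul_linear\<close>)
  moreover have "triple (y' i) (y' j) (y' k) = (if i = 1 \<and> j = 2 \<and> k = 4 then 1 else 0)"
    if "i \<in> {1..5}" "j \<in> {1..5}" "k \<in> {1..5}" "i < j" "j < k" for i j k
  proof (cases "i = 1 \<and> j = 2 \<and> k = 4")
    case True
    then show ?thesis
      using t(4) t0 unfolding x'_def y'_def \<eta>_def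
      by (simp add: form_linear mul_linear field_simps)
  qed (use that yyy in \<open>auto simp: y'_def form_linear mul_linear\<close>)
  ultimately have "normal_frame x' y'"
    unfolding normal_frame_def by blast
  then show ?thesis by blast
qed

end

subsection \<open>Presentations and structure constants\<close>

lemma finite_basis_labels: "finite (basis_labels n)"
  by (simp add: basis_labels_def)

lemma sum_basis_labels: "(\<Sum>l\<in>basis_labels n. f l) = (\<Sum>i=1..n. f (X i)) + (\<Sum>i=1..n. f (Y i))"
proof -
  have "(\<Sum>l\<in>X ` {1..n} \<union> Y ` {1..n}. f l) = sum f (X ` {1..n}) + sum f (Y ` {1..n})"
    by (rule sum.union_disjoint) auto
  then show ?thesis
    by (simp add: basis_labels_def sum.reindex inj_on_def)
qed

lemma card_basis_labels: "card (basis_labels n) = 2 * n"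
  using sum_basis_labels [of "\<lambda>_. 1 :: nat" n] by simp

lemma sum_1_5: "(\<Sum>i=1..5::nat. f i) = f 1 + f 2 + f 3 + f 4 + f 5"
proof -
  have "{1..5::nat} = {1, 2, 3, 4, 5}" by auto
  then show ?thesis by (simp add: add.assoc)
qed

text \<open>Listed triples are matched as sets of labels in \<open>has_presentation\<close>; with
  increasing Y indices such a set determines its indices.\<close>

lemma XYY_eq_iff:
  assumes "j < k" "q < r"
  shows "{X i, Y j, Y k} = {X p, Y q, Y r} \<longleftrightarrow> i = p \<and> j = q \<and> k = r"
proof
  assume eq: "{X i, Y j, Y k} = {X p, Y q, Y r}"
  have "X i \<in> {X p, Y q, Y r}" "Y j \<in> {X p, Y q, Y r}" "Y k \<in> {X p, Y q, Y r}"
    unfolding eq [symmetric] by simp_all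
  then show "i = p \<and> j = q \<and> k = r"
    using assms by auto
qed simp

lemma YYY_eq_iff:
  assumes "i < j" "j < k" "p < q" "q < r"
  shows "{Y i, Y j, Y k} = {Y p, Y q, Y r} \<longleftrightarrow> i = p \<and> j = q \<and> k = r"
proof
  assume eq: "{Y i, Y j, Y k} = {Y p, Y q, Y r}"
  have "Y i \<in> {Y p, Y q, Y r}" "Y j \<in> {Y p, Y q, Y r}" "Y k \<in> {Y p, Y q, Y r}"
    unfolding eq [symmetric] by simp_all
  then show "i = p \<and> j = q \<and> k = r"
    using assms by auto
qed simp

lemma XYY_neq_YYY: "{X i, u, v} \<noteq> {Y p, Y q, Y r}" "{Y p, Y q, Y r} \<noteq> {X i, u, v}"
  by (metis basis_label.distinct(1) insertE insertI1 singletonD)+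

context symplectic_alternating_algebra
begin

text \<open>Exchanging the roles of \<open>x\<close> and \<open>y\<close> gives a dual family
  \<open>d\<close>: pairing with \<open>d u\<close> kills every basis member other than
  \<open>b u\<close>, which yields injectivity and independence. Counting gives the span.\<close>

lemma standard_basis_of_frame:
  assumes "symplectic_frame n x y" and "dim UNIV = 2 * n"
  shows "standard_basis n (case_basis_label x y)"
proof -
  define b where "b = case_basis_label x y"
  define d where "d = case_basis_label y x"
  have b: "b (X i) = x i" "b (Y i) = y i" "d (X i) = y i" "d (Y i) = x i" for i
    by (simp_all add: b_def d_def)
  have xy: "form (x i) (x j) = 0" "form (y i) (y j) = 0" "form (x i) (y j) = (if i = j then 1 else 0)"
    "form (y j) (x i) = - (if i = j then 1 else 0)"
    if "i \<in> {1..n}" "j \<in> {1..n}" for i j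
    using assms(1) that form_skew [of "y j" "x i"] unfolding symplectic_frame_def by simp_all
  have dual: "form (b u) (d v) = 0 \<longleftrightarrow> u \<noteq> v" if "u \<in> basis_labels n" "v \<in> basis_labels n" for u v
    using that unfolding basis_labels_def by (auto simp: b xy split: if_splits)
  have inj: "inj_on b (basis_labels n)"
    using dual by (metis inj_onI)
  have "b u \<notin> span (b ` basis_labels n - {b u})" if u: "u \<in> basis_labels n" for u
  proof -
    have "span (b ` basis_labels n - {b u}) \<subseteq> {v. form v (d u) = 0}"
      using dual u by (intro span_minimal) (auto simp: subspace_def form_linear)
    then show ?thesis using dual [OF u u] by auto
  qed
  then have ind: "independent (b ` basis_labels n)"
    unfolding dependent_def by blast
  have "span (b ` basis_labels n) = UNIV"
    using ind inj assms(2) by (intro fd_independent_spans) (auto simp: card_image card_basis_labels)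
  then show ?thesis
    using inj ind xy unfolding standard_basis_def b_def [symmetric] by (auto simp: b)
qed

lemma presentation_of_normal_frame:
  assumes "normal_frame x y" and "dim UNIV = 10"
  shows "has_presentation 5 presentation_10_2_3"
proof -
  define b where "b = case_basis_label x y"
  have b: "b (X i) = x i" "b (Y i) = y i" for i
    by (simp_all add: b_def)
  \<comment> \<open>Being zero or listed is invariant under all rearrangements of the three labels,
    so it need be checked only on triples in standard order.\<close>
  define Z where "Z u v w \<longleftrightarrow> triple (b u) (b v) (b w) = 0 \<or>
    {u, v, w} \<in> {{X 3, Y 4, Y 5}, {X 2, Y 3, Y 5}, {X 1, Y 2, Y 5}, {Y 1, Y 2, Y 4}}" for u v w
  have cyc: "Z u v w \<Longrightarrow> Z w u v" for u v w
    using triple_cyclic [of "b u" "b v" "b w"] unfolding Z_def by (simp add: insert_commute)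
  have swap: "Z u v w \<Longrightarrow> Z u w v" for u v w
    using triple_swap23 [of "b u" "b w" "b v"] unfolding Z_def by (simp add: insert_commute)
  have sb: "standard_basis 5 b"
    using standard_basis_of_frame [of 5 x y] assms by (simp add: b_def normal_frame_def)
  have xx: "mul (x i) (x j) = 0" if "i \<in> {1..5}" "j \<in> {1..5}" for i j
    using assms(1) that by (simp add: normal_frame_def)
  have xyy: "triple (x i) (y j) (y k) = (if j = i + 1 \<and> k = 5 then 1 else 0)"
    if "i \<in> {1..5}" "j \<in> {1..5}" "k \<in> {1..5}" "j < k" for i j k
    using assms(1) that unfolding normal_frame_def by blast
  have yyy: "triple (y i) (y j) (y k) = (if i = 1 \<and> j = 2 \<and> k = 4 then 1 else 0)"
    if "i \<in> {1..5}" "j \<in> {1..5}" "k \<in> {1..5}" "i < j" "j < k" for i j k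
    using assms(1) that unfolding normal_frame_def by blast
  have Zxx: "Z (X i) (X j) w" if "i \<in> {1..5}" "j \<in> {1..5}" for i j w
    using xx [OF that] by (simp add: Z_def b form_linear)
  have Zxyy': "Z (X i) (Y j) (Y k)" if "i \<in> {1..5}" "j \<in> {1..5}" "k \<in> {1..5}" "j < k" for i j k
  proof (cases "j = i + 1 \<and> k = 5")
    case True
    then have "i = 1 \<and> j = 2 \<and> k = 5 \<or> i = 2 \<and> j = 3 \<and> k = 5 \<or> i = 3 \<and> j = 4 \<and> k = 5"
      using that unfolding atLeastAtMost_iff by presburger
    then show ?thesis
      unfolding Z_def by (elim disjE conjE; hypsubst; intro disjI2 insertI1 insertI2)
  qed (use xyy [OF that] in \<open>auto simp: Z_def b\<close>)
  have Zxyy: "Z (X i) (Y j) (Y k)" if "i \<in> {1..5}" "j \<in> {1..5}" "k \<in> {1..5}" for i j k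
  proof (cases j k rule: linorder_cases)
    case equal
    then show ?thesis by (simp add: Z_def triple_eq_0)
  qed (use that Zxyy' swap in blast)+
  have Zyyy': "Z (Y i) (Y j) (Y k)"
    if "i \<in> {1..5}" "j \<in> {1..5}" "k \<in> {1..5}" "i < j" "j < k" for i j k
    using yyy [OF that] by (auto simp: Z_def b)
  have Zyyy: "Z (Y i) (Y j) (Y k)" if "i \<in> {1..5}" "j \<in> {1..5}" "k \<in> {1..5}" for i j k
  proof -
    consider "i = j \<or> j = k \<or> i = k" | "i < j" "j < k" | "i < k" "k < j" | "j < i" "i < k"
      | "j < k" "k < i" | "k < i" "i < j" | "k < j" "j < i"
      by linarith
    then show ?thesis
    proof cases
      case 1
      then show ?thesis
        unfolding Z_def by (elim disjE; hypsubst) (simp_all only: triple_eq_0 simp_thms)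
    qed (use that Zyyy' swap cyc in meson)+
  qed
  have Z: "Z u v w" if "u \<in> basis_labels 5" "v \<in> basis_labels 5" "w \<in> basis_labels 5" for u v w
  proof -
    have lab: "(\<exists>i\<in>{1..5}. u = X i) \<or> (\<exists>i\<in>{1..5}. u = Y i)" if "u \<in> basis_labels 5" for u
      using that by (auto simp: basis_labels_def)
    show ?thesis
      using lab [OF that(1)] lab [OF that(2)] lab [OF that(3)]
      by (elim disjE bexE; hypsubst) (meson Zxx Zxyy Zyyy swap cyc)+
  qed
  have "form (mul (b u) (b v)) (b w) = c" if "((u, v, w), c) \<in> presentation_10_2_3" for u v w c
    using that unfolding presentation_10_2_3_def by (auto simp: b xyy yyy)
  moreover have "form (mul (b u) (b v)) (b w) = 0"
    if "u \<in> basis_labels 5" "v \<in> basis_labels 5" "w \<in> basis_labels 5"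
      "\<nexists>u' v' w' c. ((u', v', w'), c) \<in> (presentation_10_2_3 :: 'a presentation) \<and> {u, v, w} = {u', v', w'}" for u v w
    using Z [OF that(1-3)] that(4) unfolding Z_def presentation_10_2_3_def by blast
  ultimately show ?thesis
    unfolding has_presentation_def using sb by blast
qed

lemma normal_frame_of_presentation:
  assumes "has_presentation 5 presentation_10_2_3"
  obtains b where "standard_basis 5 b" "normal_frame (\<lambda>i. b (X i)) (\<lambda>i. b (Y i))"
proof -
  obtain b where sb: "standard_basis 5 b"
    and listed: "\<forall>((u, v, w), c) \<in> presentation_10_2_3. form (mul (b u) (b v)) (b w) = c"
    and zero': "\<forall>u \<in> basis_labels 5. \<forall>v \<in> basis_labels 5. \<forall>w \<in> basis_labels 5.
      (\<nexists>u' v' w' c. ((u', v', w'), c) \<in> (presentation_10_2_3 :: 'a presentation) \<and> {u, v, w} = {u', v', w'}) \<longrightarrow>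
      form (mul (b u) (b v)) (b w) = 0"
    using assms unfolding has_presentation_def by blast
  have one: "form (mul (b u) (b v)) (b w) = c" if "((u, v, w), c) \<in> presentation_10_2_3" for u v w c
    using listed that by blast
  have zero: "form (mul (b u) (b v)) (b w) = 0"
    if "u \<in> basis_labels 5" "v \<in> basis_labels 5" "w \<in> basis_labels 5"
      "{u, v, w} \<notin> {{X 3, Y 4, Y 5}, {X 2, Y 3, Y 5}, {X 1, Y 2, Y 5}, {Y 1, Y 2, Y 4}}" for u v w
    using that(4) by (intro zero' [rule_format] that) (simp add: presentation_10_2_3_def; blast)
  have lab: "X i \<in> basis_labels 5" "Y i \<in> basis_labels 5" if "i \<in> {1..5}" for i
    using that by (auto simp: basis_labels_def)
  have "mul (b (X i)) (b (X j)) = 0" if ij: "i \<in> {1..5}" "j \<in> {1..5}" for i j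
  proof (rule form_nondegenerate, rule allI)
    fix z
    have *: "form (mul (b (X i)) (b (X j))) (b w) = 0" if "w \<in> basis_labels 5" for w
    proof (cases "i = j")
      case False
      have "{X i, X j, w} \<notin> {{X 3, Y 4, Y 5}, {X 2, Y 3, Y 5}, {X 1, Y 2, Y 5}, {Y 1, Y 2, Y 4}}"
      proof -
        \<comment> \<open>A listed triple has at least two Y labels, so two distinct X labels never
          occur together.\<close>
        have "{X i, X j, w} \<noteq> {u, Y q, Y r}" for u q r
        proof
          assume "{X i, X j, w} = {u, Y q, Y r}"
          then have "X i \<in> {u, Y q, Y r}" "X j \<in> {u, Y q, Y r}" by blast+
          then show False using False by auto
        qed
        then show ?thesis by simp
      qed
      then show ?thesis
        by (rule zero [OF lab(1) [OF ij(1)] lab(1) [OF ij(2)] that])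
    qed (simp add: mul_alternating form_linear)
    have "span (b ` basis_labels 5) \<subseteq> {z. form (mul (b (X i)) (b (X j))) z = 0}"
      using * by (intro span_minimal) (auto simp: subspace_def form_linear)
    then show "form (mul (b (X i)) (b (X j))) z = 0"
      using sb by (auto simp: standard_basis_def)
  qed
  moreover have "triple (b (X i)) (b (Y j)) (b (Y k)) = (if j = i + 1 \<and> k = 5 then 1 else 0)"
    if ijk: "i \<in> {1..5}" "j \<in> {1..5}" "k \<in> {1..5}" "j < k" for i j k
  proof (cases "j = i + 1 \<and> k = 5")
    case True
    then have "i = 1 \<and> j = 2 \<or> i = 2 \<and> j = 3 \<or> i = 3 \<and> j = 4"
      using that unfolding atLeastAtMost_iff by presburger
    then show ?thesis
      using True by (intro one) (auto simp: presentation_10_2_3_def)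
  next
    case False
    have "{X i, Y j, Y k} \<notin> {{X 3, Y 4, Y 5}, {X 2, Y 3, Y 5}, {X 1, Y 2, Y 5}, {Y 1, Y 2, Y 4}}"
      using False ijk by (auto simp: XYY_eq_iff XYY_neq_YYY)
    then show ?thesis
      using zero lab ijk False by auto
  qed
  moreover have "triple (b (Y i)) (b (Y j)) (b (Y k)) = (if i = 1 \<and> j = 2 \<and> k = 4 then 1 else 0)"
    if ijk: "i \<in> {1..5}" "j \<in> {1..5}" "k \<in> {1..5}" "i < j" "j < k" for i j k
  proof (cases "i = 1 \<and> j = 2 \<and> k = 4")
    case True
    then show ?thesis
      by (intro one) (auto simp: presentation_10_2_3_def)
  next
    case False
    have "{Y i, Y j, Y k} \<notin> {{X 3, Y 4, Y 5}, {X 2, Y 3, Y 5}, {X 1, Y 2, Y 5}, {Y 1, Y 2, Y 4}}"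
      using False ijk by (simp add: YYY_eq_iff XYY_neq_YYY)
    then show ?thesis
      using zero lab ijk False by auto
  qed
  moreover have "symplectic_frame 5 (\<lambda>i. b (X i)) (\<lambda>i. b (Y i))"
    using sb by (simp add: standard_basis_def symplectic_frame_def)
  ultimately show thesis
    by (intro that [OF sb]) (simp add: normal_frame_def)
qed

end

text \<open>The coordinate at \<open>l\<close> of a product, in terms of the coordinates \<open>p\<close> and \<open>q\<close> of the factors
  with respect to a standard basis with the presentation.\<close>

definition mult_coord :: "(basis_label \<Rightarrow> 'a::field) \<Rightarrow> (basis_label \<Rightarrow> 'a) \<Rightarrow> basis_label \<Rightarrow> 'a" where
  "mult_coord p q l = (let d = (\<lambda>s t. p s * q t - p t * q s) in
     if l = X 5 then d (X 3) (Y 4) + d (X 2) (Y 3) + d (X 1) (Y 2)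
     else if l = X 4 then d (Y 1) (Y 2) - d (X 3) (Y 5)
     else if l = X 3 then - d (X 2) (Y 5)
     else if l = X 2 then - d (X 1) (Y 5) - d (Y 1) (Y 4)
     else if l = X 1 then d (Y 2) (Y 4)
     else if l = Y 1 then - d (Y 2) (Y 5)
     else if l = Y 2 then - d (Y 3) (Y 5)
     else if l = Y 3 then - d (Y 4) (Y 5)
     else 0)"

definition form_coord :: "(basis_label \<Rightarrow> 'a::field) \<Rightarrow> (basis_label \<Rightarrow> 'a) \<Rightarrow> 'a" where
  "form_coord p q = (\<Sum>i=1..5. p (X i) * q (Y i) - p (Y i) * q (X i))"

section \<open>Coordinates in an algebra with the presentation\<close>

locale presented_saa = symplectic_alternating_algebra +
  fixes b :: "basis_label \<Rightarrow> 'b"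
  assumes basis: "standard_basis 5 b"
    and normal: "normal_frame (\<lambda>i. b (X i)) (\<lambda>i. b (Y i))"
begin

text \<open>Coefficients are read off by pairing with the dual basis member; the order of the
  arguments absorbs the sign. Only labels in \<open>basis_labels 5\<close> give genuine coordinates,
  hence the restriction in the lemmas below.\<close>

definition coord :: "'b \<Rightarrow> basis_label \<Rightarrow> 'a" where
  "coord v l = (case l of X i \<Rightarrow> form v (b (Y i)) | Y i \<Rightarrow> form (b (X i)) v)"

lemma coord_X: "coord v (X i) = form v (b (Y i))"
  and coord_Y: "coord v (Y i) = form (b (X i)) v"
  by (simp_all add: coord_def)

lemma coord_linear: "coord (u + v) l = coord u l + coord v l" "coord (smul c v) l = c * coord v l"
    "coord 0 l = 0" "coord (- v) l = - coord v l"
  by (cases l; simp add: coord_def form_linear)+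

lemma form_b: "\<lbrakk>i \<in> {1..5}; j \<in> {1..5}\<rbrakk> \<Longrightarrow> form (b (X i)) (b (X j)) = 0"
    "\<lbrakk>i \<in> {1..5}; j \<in> {1..5}\<rbrakk> \<Longrightarrow> form (b (Y i)) (b (Y j)) = 0"
    "\<lbrakk>i \<in> {1..5}; j \<in> {1..5}\<rbrakk> \<Longrightarrow> form (b (X i)) (b (Y j)) = (if i = j then 1 else 0)"
  using basis unfolding standard_basis_def by blast+

lemma span_b: "span (b ` basis_labels 5) = UNIV"
  and independent_b: "independent (b ` basis_labels 5)"
  and inj_b: "inj_on b (basis_labels 5)"
  using basis unfolding standard_basis_def by blast+

lemma coord_b:
  assumes "l \<in> basis_labels 5" "m \<in> basis_labels 5"
  shows "coord (b l) m = (if l = m then 1 else 0)"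
  using assms unfolding basis_labels_def by (auto simp: coord_def form_b split: if_splits)

lemma coord_eqI:
  assumes "\<And>l. l \<in> basis_labels 5 \<Longrightarrow> coord u l = coord v l"
  shows "u = v"
proof -
  have "form z (u - v) = 0" if "z \<in> b ` basis_labels 5" for z
  proof -
    have X: "form (b (X i)) u = form (b (X i)) v" if "i \<in> {1..5}" for i
      using assms [of "Y i"] that by (simp add: coord_Y basis_labels_def)
    have "form u (b (Y i)) = form v (b (Y i))" if "i \<in> {1..5}" for i
      using assms [of "X i"] that by (simp add: coord_X basis_labels_def)
    then have "form (b (Y i)) u = form (b (Y i)) v" if "i \<in> {1..5}" for i
      using that form_skew [of "b (Y i)"] by simp
    then show ?thesis
      using X that unfolding basis_labels_def by (auto simp: form_linear)
  qed
  then have "span (b ` basis_labels 5) \<subseteq> {z. form z (u - v) = 0}"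
    by (intro span_minimal) (auto simp: subspace_def form_linear)
  then have "form (u - v) z = 0" for z
    using span_b form_eq_0_commute [of z] by auto
  then show ?thesis
    using form_nondegenerate [of "u - v"] by simp
qed

definition vec_of :: "(basis_label \<Rightarrow> 'a) \<Rightarrow> 'b" where
  "vec_of p = (\<Sum>l\<in>basis_labels 5. smul (p l) (b l))"

lemma coord_sum: "coord (\<Sum>i\<in>A. f i) l = (\<Sum>i\<in>A. coord (f i) l)"
  by (induction A rule: infinite_finite_induct) (auto simp: coord_linear)

lemma coord_vec_of: "l \<in> basis_labels 5 \<Longrightarrow> coord (vec_of p) l = p l"
proof -
  assume l: "l \<in> basis_labels 5"
  have "coord (vec_of p) l = (\<Sum>m\<in>basis_labels 5. if m = l then p m else 0)"
    unfolding vec_of_def coord_sum by (intro sum.cong refl) (use l in \<open>auto simp: coord_linear coord_b\<close>)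
  then show ?thesis
    using l by (simp add: finite_basis_labels)
qed

lemma vec_of_coord: "vec_of (coord v) = v"
  by (rule coord_eqI) (rule coord_vec_of)

lemma vec_of_expand: "vec_of p =
   smul (p (X 1)) (b (X 1)) + smul (p (X 2)) (b (X 2)) + smul (p (X 3)) (b (X 3)) +
   smul (p (X 4)) (b (X 4)) + smul (p (X 5)) (b (X 5)) +
   (smul (p (Y 1)) (b (Y 1)) + smul (p (Y 2)) (b (Y 2)) + smul (p (Y 3)) (b (Y 3)) +
   smul (p (Y 4)) (b (Y 4)) + smul (p (Y 5)) (b (Y 5)))"
  unfolding vec_of_def sum_basis_labels sum_1_5 ..

lemma form_eq: "form u v = form_coord (coord u) (coord v)"
proof -
  have "form u v = form (vec_of (coord u)) v"
    by (simp add: vec_of_coord)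
  also have "\<dots> = (\<Sum>i=1..5. coord u (X i) * coord v (Y i)) + (\<Sum>i=1..5. coord u (Y i) * form (b (Y i)) v)"
    unfolding vec_of_def sum_basis_labels by (simp add: form_linear form_sum_left coord_Y)
  also have "\<dots> = form_coord (coord u) (coord v)"
    unfolding form_coord_def sum_subtractf
    by (simp add: coord_X form_skew [of "b (Y _)"] sum_negf)
  finally show ?thesis .
qed

lemma triple_b:
    "\<lbrakk>i \<in> {1..5}; j \<in> {1..5}\<rbrakk> \<Longrightarrow> mul (b (X i)) (b (X j)) = 0"
    "\<lbrakk>i \<in> {1..5}; j \<in> {1..5}; k \<in> {1..5}; j < k\<rbrakk> \<Longrightarrow>
      triple (b (X i)) (b (Y j)) (b (Y k)) = (if j = i + 1 \<and> k = 5 then 1 else 0)"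
    "\<lbrakk>i \<in> {1..5}; j \<in> {1..5}; k \<in> {1..5}; i < j; j < k\<rbrakk> \<Longrightarrow>
      triple (b (Y i)) (b (Y j)) (b (Y k)) = (if i = 1 \<and> j = 2 \<and> k = 4 then 1 else 0)"
    "triple (b (Y i)) (b (X j)) w = - triple (b (X j)) (b (Y i)) w"
    "triple (b (Y i)) (b (Y j)) (b (X k)) = triple (b (X k)) (b (Y i)) (b (Y j))"
    "j < i \<Longrightarrow> triple (b (Y i)) (b (Y j)) w = - triple (b (Y j)) (b (Y i)) w"
    "k < j \<Longrightarrow> triple w (b (Y j)) (b (Y k)) = - triple w (b (Y k)) (b (Y j))"
  subgoal using normal unfolding normal_frame_def by blast
  subgoal using normal unfolding normal_frame_def by blast
  subgoal using normal unfolding normal_frame_def by blast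
  subgoal by (rule triple_swap12)
  subgoal by (rule triple_cyclic)
  subgoal by (rule triple_swap12)
  subgoal by (rule triple_swap23)
  done

lemma triple_b_XYX: "\<lbrakk>i \<in> {1..5}; k \<in> {1..5}\<rbrakk> \<Longrightarrow> triple (b (X i)) w (b (X k)) = 0"
  using triple_cyclic [of "b (X i)" w "b (X k)"] by (simp only: triple_b form_zero_left)

text \<open>With both factors expanded into ten explicit terms, every coordinate of the product
  becomes a polynomial identity once the triples of basis members are evaluated.\<close>

lemma coord_mul_vec_of:
  "l \<in> basis_labels 5 \<Longrightarrow> coord (mul (vec_of p) (vec_of q)) l = mult_coord p q l"
proof -
  have X: "coord (mul (vec_of p) (vec_of q)) (X i) = mult_coord p q (X i)" if "i \<in> {1, 2, 3, 4, 5}" for i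
    using that unfolding coord_X vec_of_expand
    by (elim insertE emptyE; hypsubst)
      (simp_all add: form_linear mul_linear triple_b triple_b_XYX triple_eq_0 mult_coord_def algebra_simps)
  have Y: "coord (mul (vec_of p) (vec_of q)) (Y i) = mult_coord p q (Y i)" if "i \<in> {1, 2, 3, 4, 5}" for i
    using that unfolding coord_Y form_skew [of "b (X i)"] vec_of_expand
    by (elim insertE emptyE; hypsubst)
      (simp_all add: form_linear mul_linear triple_b triple_b_XYX triple_eq_0 mult_coord_def algebra_simps)
  have "{1..5::nat} = {1, 2, 3, 4, 5}" by auto
  moreover assume "l \<in> basis_labels 5"
  ultimately show ?thesis
    using X Y unfolding basis_labels_def by blast
qed

lemma coord_mul: "l \<in> basis_labels 5 \<Longrightarrow> coord (mul u v) l = mult_coord (coord u) (coord v) l"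
  using coord_mul_vec_of [of l "coord u" "coord v"] by (simp add: vec_of_coord)

end

lemma basis_labels_5: "basis_labels 5 = {X 1, X 2, X 3, X 4, X 5, Y 1, Y 2, Y 3, Y 4, Y 5}"
proof -
  have "{1..5::nat} = {1, 2, 3, 4, 5}" by auto
  then show ?thesis by (auto simp: basis_labels_def)
qed

lemma form_coord_expand:
  "form_coord p q = p (X 1) * q (Y 1) - p (Y 1) * q (X 1) + (p (X 2) * q (Y 2) - p (Y 2) * q (X 2)) +
     (p (X 3) * q (Y 3) - p (Y 3) * q (X 3)) + (p (X 4) * q (Y 4) - p (Y 4) * q (X 4)) +
     (p (X 5) * q (Y 5) - p (Y 5) * q (X 5))"
  unfolding form_coord_def by (rule sum_1_5)

text \<open>An entry \<open>(s, t, l)\<close> stands for a product of two members of the basis that is the member \<open>l\<close>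
  up to sign.\<close>

definition basis_products :: "(basis_label \<times> basis_label \<times> basis_label) set" where
  "basis_products = {(X 3, Y 4, X 5), (X 2, Y 3, X 5), (X 1, Y 2, X 5), (Y 1, Y 2, X 4), (Y 2, Y 4, X 1),
     (X 3, Y 5, X 4), (X 2, Y 5, X 3), (X 1, Y 5, X 2), (Y 2, Y 5, Y 1), (Y 3, Y 5, Y 2), (Y 4, Y 5, Y 3)}"

section \<open>Invariants read off from the structure constants\<close>

context presented_saa
begin

text \<open>The span of the basis members with labels in \<open>S\<close>, described by vanishing
  coordinates so that membership of a product can be tested with \<open>mult_coord\<close>.\<close>

definition coord_space :: "basis_label set \<Rightarrow> 'b set" where
  "coord_space S = {v. \<forall>l\<in>basis_labels 5 - S. coord v l = 0}"

lemma coord_space_subspace: "subspace (coord_space S)"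
  by (auto simp: coord_space_def subspace_def coord_linear)

lemma b_mem_coord_space: "S \<subseteq> basis_labels 5 \<Longrightarrow> l \<in> S \<Longrightarrow> b l \<in> coord_space S"
  using coord_b [of l] by (auto simp: coord_space_def)

lemma coord_space_subset:
  assumes "S \<subseteq> basis_labels 5" "subspace W" "\<And>l. l \<in> S \<Longrightarrow> b l \<in> W"
  shows "coord_space S \<subseteq> W"
proof
  fix v assume v: "v \<in> coord_space S"
  have "vec_of (coord v) \<in> W"
    unfolding vec_of_def
  proof (rule subspace_sum [OF assms(2)])
    fix l assume "l \<in> basis_labels 5"
    then show "smul (coord v l) (b l) \<in> W"
      using v assms(2,3) by (cases "l \<in> S") (auto simp: coord_space_def subspace_scale subspace_0)
  qed
  then show "v \<in> W" by (simp add: vec_of_coord)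
qed

lemma coord_space_eq_span: "S \<subseteq> basis_labels 5 \<Longrightarrow> coord_space S = span (b ` S)"
proof
  assume S: "S \<subseteq> basis_labels 5"
  show "coord_space S \<subseteq> span (b ` S)"
    using S by (rule coord_space_subset) (auto intro: span_base)
  show "span (b ` S) \<subseteq> coord_space S"
    using S by (intro span_minimal coord_space_subspace) (auto intro: b_mem_coord_space)
qed

lemma dim_coord_space:
  assumes "S \<subseteq> basis_labels 5"
  shows "dim (coord_space S) = card S"
proof -
  have "independent (b ` S)"
    using independent_b assms by (meson image_mono independent_mono)
  then show ?thesis
    using assms inj_on_subset [OF inj_b assms]
    by (simp add: coord_space_eq_span dim_span_eq_card_independent card_image dim_eq_card_independent)
qed

lemma mul_b:
  assumes "(s, t, l) \<in> basis_products"
  shows "mul (b s) (b t) = b l \<or> mul (b s) (b t) = - b l"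
proof -
  \<comment> \<open>The five pairs in the condition have product plus a basis member; the other six
    in the table have product minus one.\<close>
  have "coord (mul (b s) (b t)) m = (if (s, t) \<in> {(X 3, Y 4), (X 2, Y 3), (X 1, Y 2), (Y 1, Y 2), (Y 2, Y 4)}
      then coord (b l) m else coord (- b l) m)" if "m \<in> basis_labels 5" for m
    using assms that unfolding basis_products_def basis_labels_5
    by (elim insertE emptyE; clarify)
      (simp_all add: coord_mul mult_coord_def coord_b coord_linear basis_labels_5)
  then show ?thesis
    by (metis (no_types, lifting) coord_eqI)
qed

text \<open>Products of coordinate subspaces reduce to finite checks: \<open>le\<close> bounds the
  product from above by vanishing coordinates, and \<open>ge\<close> exhibits each basis member of
  the result, up to sign, as a single product.\<close>

lemma set_prod_coord_space:
  assumes sub: "R \<subseteq> basis_labels 5" "S \<subseteq> basis_labels 5" "T \<subseteq> basis_labels 5"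
    and le: "\<And>p q :: basis_label \<Rightarrow> 'a. \<lbrakk>\<forall>l\<in>basis_labels 5 - S. p l = 0; \<forall>l\<in>basis_labels 5 - T. q l = 0\<rbrakk> \<Longrightarrow>
      \<forall>l\<in>basis_labels 5 - R. mult_coord p q l = 0"
    and ge: "\<forall>l\<in>R. \<exists>s\<in>S. \<exists>t\<in>T. (s, t, l) \<in> basis_products"
  shows "set_prod (coord_space S) (coord_space T) = coord_space R"
proof
  show "set_prod (coord_space S) (coord_space T) \<subseteq> coord_space R"
  proof (rule set_prod_minimal [OF coord_space_subspace])
    fix u v assume "u \<in> coord_space S" "v \<in> coord_space T"
    then show "mul u v \<in> coord_space R"
      using le [of "coord u" "coord v"] by (simp add: coord_space_def coord_mul)
  qed
  show "coord_space R \<subseteq> set_prod (coord_space S) (coord_space T)"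
  proof (rule coord_space_subset [OF sub(1) set_prod_subspace])
    fix l assume "l \<in> R"
    then obtain s t where st: "s \<in> S" "t \<in> T" "(s, t, l) \<in> basis_products"
      using ge by blast
    have "mul (b s) (b t) \<in> set_prod (coord_space S) (coord_space T)"
      using st sub by (intro set_prod_base b_mem_coord_space)
    then show "b l \<in> set_prod (coord_space S) (coord_space T)"
      using mul_b [OF st(3)] subspace_neg [OF set_prod_subspace, of "mul (b s) (b t)" "coord_space S" "coord_space T"]
      by auto
  qed
qed

lemma coord_space_UNIV: "UNIV = coord_space (basis_labels 5)"
  by (simp add: coord_space_def)

lemma lcs_2_eq: "lcs 2 = coord_space {X 1, X 2, X 3, X 4, X 5, Y 1, Y 2, Y 3}"
proof -
  have "lcs 2 = set_prod (coord_space (basis_labels 5)) (coord_space (basis_labels 5))"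
    unfolding coord_space_UNIV [symmetric] by (simp add: numeral_2_eq_2)
  also have "\<dots> = coord_space {X 1, X 2, X 3, X 4, X 5, Y 1, Y 2, Y 3}"
    unfolding basis_labels_5
    by (rule set_prod_coord_space)
      (simp_all add: basis_labels_5 mult_coord_def insert_Diff_if basis_products_def)
  finally show ?thesis .
qed

lemma lcs_Suc_eq:
  assumes "lcs k = coord_space S" "0 < k" "set_prod (coord_space S) (coord_space (basis_labels 5)) = coord_space R"
  shows "lcs (Suc k) = coord_space R"
  using assms lcs_Suc [of k] coord_space_UNIV by simp

lemma lcs_3_eq: "lcs 3 = coord_space {X 1, X 2, X 3, X 4, X 5, Y 1, Y 2}"
  using lcs_Suc_eq [OF lcs_2_eq, of "{X 1, X 2, X 3, X 4, X 5, Y 1, Y 2}"]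
  unfolding basis_labels_5
  by (simp add: set_prod_coord_space basis_labels_5 mult_coord_def insert_Diff_if basis_products_def)

lemma lcs_4_eq: "lcs 4 = coord_space {X 1, X 2, X 3, X 4, X 5, Y 1}"
  using lcs_Suc_eq [OF lcs_3_eq, of "{X 1, X 2, X 3, X 4, X 5, Y 1}"]
  unfolding basis_labels_5
  by (simp add: set_prod_coord_space basis_labels_5 mult_coord_def insert_Diff_if basis_products_def)

lemma lcs_5_eq: "lcs 5 = coord_space {X 2, X 3, X 4, X 5}"
  using lcs_Suc_eq [OF lcs_4_eq, of "{X 2, X 3, X 4, X 5}"]
  unfolding basis_labels_5
  by (simp add: set_prod_coord_space basis_labels_5 mult_coord_def insert_Diff_if basis_products_def)

lemma lcs_6_eq: "lcs 6 = coord_space {X 3, X 4, X 5}"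
  using lcs_Suc_eq [OF lcs_5_eq, of "{X 3, X 4, X 5}"]
  unfolding basis_labels_5
  by (simp add: set_prod_coord_space basis_labels_5 mult_coord_def insert_Diff_if basis_products_def)

lemma lcs_7_eq: "lcs 7 = coord_space {X 4, X 5}"
  using lcs_Suc_eq [OF lcs_6_eq, of "{X 4, X 5}"]
  unfolding basis_labels_5
  by (simp add: set_prod_coord_space basis_labels_5 mult_coord_def insert_Diff_if basis_products_def)

lemma lcs_8_eq: "lcs 8 = {0}"
proof -
  have "lcs 8 = coord_space {}"
    using lcs_Suc_eq [OF lcs_7_eq, of "{}"]
    unfolding basis_labels_5
    by (simp add: set_prod_coord_space basis_labels_5 mult_coord_def insert_Diff_if basis_products_def)
  then show ?thesis by (simp add: coord_space_eq_span)
qed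

lemma L4_L3_eq: "set_prod (lcs 4) (lcs 3) = coord_space {X 4, X 5}"
  unfolding lcs_3_eq lcs_4_eq
  by (rule set_prod_coord_space)
    (simp_all add: basis_labels_5 mult_coord_def insert_Diff_if basis_products_def)

lemma L5_L2_eq: "set_prod (lcs 5) (lcs 2) = coord_space {X 5}"
  unfolding lcs_5_eq lcs_2_eq
  by (rule set_prod_coord_space)
    (simp_all add: basis_labels_5 mult_coord_def insert_Diff_if basis_products_def)

lemma U_index_eq: "U_index = 1"
  unfolding U_index_def
proof (rule Least_equality)
  have "b (X 5) \<in> U_ideal 1 \<inter> set_prod (lcs 4) (lcs 3)"
    by (simp add: U_ideal_def L5_L2_eq L4_L3_eq b_mem_coord_space basis_labels_5)
  moreover have "b (X 5) \<noteq> 0"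
    using coord_b [of "X 5" "X 5"] coord_linear(3) [of "X 5"] by (auto simp: basis_labels_5)
  ultimately show "1 \<in> {1::nat, 2, 3} \<and> U_ideal 1 \<inter> set_prod (lcs 4) (lcs 3) \<noteq> {0}"
    by auto
qed auto

lemma U_eq_coord_space: "U = coord_space {X 1, X 2, X 3, X 4, X 5}"
proof -
  have U: "U = {x \<in> lcs 4. \<forall>a\<in>lcs 3. mul x a \<in> coord_space {X 5}}"
    by (simp add: U_def U_index_eq U_ideal_def L5_L2_eq)
  show ?thesis
  proof
    show "U \<subseteq> coord_space {X 1, X 2, X 3, X 4, X 5}"
    proof
      fix x assume "x \<in> U"
      then have x4: "x \<in> lcs 4" and "mul x (b (Y 2)) \<in> coord_space {X 5}"
        using U by (auto simp: lcs_3_eq b_mem_coord_space basis_labels_5)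
      \<comment> \<open>On multiplication by y_2, the coordinate at x_4 of the product is the
        coordinate of \<open>x\<close> at y_1, the only one that separates L^4 from the claimed
        U.\<close>
      then have "mult_coord (coord x) (coord (b (Y 2))) (X 4) = 0"
        using coord_mul [of "X 4" x "b (Y 2)"] by (simp add: coord_space_def basis_labels_5)
      then show "x \<in> coord_space {X 1, X 2, X 3, X 4, X 5}"
        using x4 unfolding lcs_4_eq coord_space_def
        by (simp add: mult_coord_def coord_b basis_labels_5 insert_Diff_if)
    qed
    show "coord_space {X 1, X 2, X 3, X 4, X 5} \<subseteq> U"
      unfolding U lcs_3_eq lcs_4_eq
      by (auto simp: coord_space_def coord_mul mult_coord_def basis_labels_5 insert_Diff_if)
  qed
qed

lemma center_eq: "center = coord_space {X 4, X 5}"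
proof
  show "center \<subseteq> coord_space {X 4, X 5}"
  proof
    fix z assume "z \<in> center"
    then have "mult_coord (coord z) (coord (b m)) l = 0" if "m \<in> basis_labels 5" "l \<in> basis_labels 5" for l m
      using coord_mul [of l z "b m"] that by (simp add: center_def coord_linear)
    \<comment> \<open>Each of these eight choices of a basis factor and a coordinate isolates, up to
      sign, one coordinate of \<open>z\<close>: in turn those at x_3, x_2, x_1, y_2, y_3, y_4, y_5,
      y_1.\<close>
    from this [of "Y 4" "X 5"] this [of "Y 3" "X 5"] this [of "Y 2" "X 5"] this [of "Y 5" "Y 1"]
      this [of "Y 5" "Y 2"] this [of "Y 5" "Y 3"] this [of "Y 4" "Y 3"] this [of "Y 2" "X 4"]
    show "z \<in> coord_space {X 4, X 5}"
      by (simp add: coord_space_def mult_coord_def coord_b basis_labels_5 insert_Diff_if)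
  qed
  show "coord_space {X 4, X 5} \<subseteq> center"
  proof
    fix z assume "z \<in> coord_space {X 4, X 5}"
    then have "coord (mul z v) l = coord 0 l" if "l \<in> basis_labels 5" for v l
      using that by (auto simp: coord_space_def coord_mul coord_linear mult_coord_def basis_labels_5 insert_Diff_if)
    then show "z \<in> center"
      using coord_eqI [of _ 0] by (auto simp: center_def)
  qed
qed

lemma presented_saa_10_2_3: "saa_10_2_3 smul form mul"
proof
  have nz: "b (X 5) \<noteq> 0"
    using coord_b [of "X 5" "X 5"] coord_linear(3) [of "X 5"] by (auto simp: basis_labels_5)
  have b7: "b (X 5) \<in> lcs 7"
    by (simp add: lcs_7_eq b_mem_coord_space basis_labels_5)
  show "nilpotent"
    unfolding nilpotent_def using lcs_8_eq by (intro exI [of _ 7]) simp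
  show "nilpotence_class = 7"
    unfolding nilpotence_class_def
  proof (rule Least_equality)
    fix k assume k: "lcs (k + 1) = {0}"
    show "7 \<le> k"
    proof (rule ccontr)
      assume "\<not> 7 \<le> k"
      then have "lcs 7 \<subseteq> lcs (k + 1)"
        by (intro lcs_antimono) simp
      then show False
        using b7 nz k by auto
    qed
  qed (simp add: lcs_8_eq)
  show "dim UNIV = 10"
    unfolding coord_space_UNIV by (simp add: dim_coord_space card_basis_labels)
  show "isotropic center"
    unfolding isotropic_def center_eq
    by (auto simp: form_eq form_coord_expand coord_space_def basis_labels_5 insert_Diff_if)
  show "dim center = 2"
    unfolding center_eq by (subst dim_coord_space) (auto simp: basis_labels_5)
  show "set_prod (lcs 4) (lcs 3) = lcs 7"
    by (simp add: L4_L3_eq lcs_7_eq)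
  have "set_prod U (lcs 2) = coord_space {X 5}"
    unfolding U_eq_coord_space lcs_2_eq
    by (rule set_prod_coord_space)
      (simp_all add: basis_labels_5 mult_coord_def insert_Diff_if basis_products_def)
  then show "dim (set_prod U (lcs 2)) = 1"
    by (simp add: dim_coord_space basis_labels_5)
qed

end

subsection \<open>Uniqueness and existence\<close>

lemma mult_coord_cong:
  assumes "\<And>l. l \<in> basis_labels 5 \<Longrightarrow> p l = p' l" "\<And>l. l \<in> basis_labels 5 \<Longrightarrow> q l = q' l"
  shows "mult_coord p q = mult_coord p' q'"
proof -
  have "\<forall>l\<in>basis_labels 5. p l = p' l \<and> q l = q' l"
    using assms by blast
  then show ?thesis
    unfolding basis_labels_5 by (simp add: mult_coord_def fun_eq_iff)
qed

lemma form_coord_cong: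
  assumes "\<And>l. l \<in> basis_labels 5 \<Longrightarrow> p l = p' l" "\<And>l. l \<in> basis_labels 5 \<Longrightarrow> q l = q' l"
  shows "form_coord p q = form_coord p' q'"
  unfolding form_coord_def using assms by (intro sum.cong) (auto simp: basis_labels_def)

text \<open>\<open>mult_coord\<close> and \<open>form_coord\<close> are the same for both algebras,
  so the map that keeps coordinates preserves product and form, and transport in the other direction
  inverts it.\<close>

lemma presented_saa_isomorphic:
  assumes "presented_saa smul form mul b" and "presented_saa smul' form' mul' b'"
  shows "saa_isomorphic smul form mul smul' form' mul'"
proof -
  interpret A: presented_saa smul form mul b by (rule assms(1))
  interpret B: presented_saa smul' form' mul' b' by (rule assms(2))
  define f where "f v = B.vec_of (A.coord v)" for v
  define g where "g w = A.vec_of (B.coord w)" for w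
  have f: "B.coord (f v) l = A.coord v l" if "l \<in> basis_labels 5" for v l
    using that by (simp add: f_def B.coord_vec_of)
  have g: "A.coord (g w) l = B.coord w l" if "l \<in> basis_labels 5" for w l
    using that by (simp add: g_def A.coord_vec_of)
  have "Vector_Spaces.linear smul smul' f"
    unfolding Vector_Spaces.linear_iff
    using A.vector_space_axioms B.vector_space_axioms
    by (auto intro!: B.coord_eqI simp: f A.coord_linear B.coord_linear)
  moreover have "bij f"
  proof (rule o_bij)
    show "g \<circ> f = id"
      by (auto intro!: A.coord_eqI simp: fun_eq_iff f g)
    show "f \<circ> g = id"
      by (auto intro!: B.coord_eqI simp: fun_eq_iff f g)
  qed
  moreover have "f (mul x y) = mul' (f x) (f y)" for x y
  proof (rule B.coord_eqI)
    fix l assume l: "l \<in> basis_labels 5"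
    have "mult_coord (B.coord (f x)) (B.coord (f y)) = mult_coord (A.coord x) (A.coord y)"
      by (rule mult_coord_cong) (simp_all add: f)
    then show "B.coord (f (mul x y)) l = B.coord (mul' (f x) (f y)) l"
      using l by (simp add: f A.coord_mul B.coord_mul)
  qed
  moreover have "form' (f x) (f y) = form x y" for x y
  proof -
    have "form_coord (B.coord (f x)) (B.coord (f y)) = form_coord (A.coord x) (A.coord y)"
      by (rule form_coord_cong) (simp_all add: f)
    then show ?thesis
      using A.form_eq [of x y] B.form_eq [of "f x" "f y"] by simp
  qed
  ultimately show ?thesis
    unfolding saa_isomorphic_def by blast
qed

section \<open>A model on coordinate space\<close>

lemma mult_coord_linear:
  "mult_coord (\<lambda>l. p l + p' l) q m = mult_coord p q m + mult_coord p' q m"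
  "mult_coord (\<lambda>l. c * p l) q m = c * mult_coord p q m"
  "mult_coord p (\<lambda>l. q l + q' l) m = mult_coord p q m + mult_coord p q' m"
  "mult_coord p (\<lambda>l. c * q l) m = c * mult_coord p q m"
  by (simp_all add: mult_coord_def algebra_simps)

lemma form_coord_linear:
  "form_coord (\<lambda>l. p l + p' l) q = form_coord p q + form_coord p' q"
  "form_coord (\<lambda>l. c * p l) q = c * form_coord p q"
  "form_coord p (\<lambda>l. q l + q' l) = form_coord p q + form_coord p q'"
  "form_coord p (\<lambda>l. c * q l) = c * form_coord p q"
  unfolding form_coord_expand by (simp_all add: algebra_simps)

text \<open>The right-hand side is the sum of four 3 by 3 determinants in the coordinates of
  \<open>p\<close>, \<open>q\<close>, \<open>r\<close>, one for each listed triple, expanded along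
  \<open>r\<close>. Cyclic symmetry becomes visible in this shape.\<close>

lemma form_coord_mult_coord:
  "form_coord (mult_coord p q) r =
     (p (X 3) * q (Y 4) - p (Y 4) * q (X 3) + (p (X 2) * q (Y 3) - p (Y 3) * q (X 2)) +
       (p (X 1) * q (Y 2) - p (Y 2) * q (X 1))) * r (Y 5) +
     (p (Y 1) * q (Y 2) - p (Y 2) * q (Y 1) - (p (X 3) * q (Y 5) - p (Y 5) * q (X 3))) * r (Y 4) -
     (p (X 2) * q (Y 5) - p (Y 5) * q (X 2)) * r (Y 3) -
     (p (X 1) * q (Y 5) - p (Y 5) * q (X 1) + (p (Y 1) * q (Y 4) - p (Y 4) * q (Y 1))) * r (Y 2) +
     (p (Y 2) * q (Y 4) - p (Y 4) * q (Y 2)) * r (Y 1) +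
     (p (Y 2) * q (Y 5) - p (Y 5) * q (Y 2)) * r (X 1) +
     (p (Y 3) * q (Y 5) - p (Y 5) * q (Y 3)) * r (X 2) +
     (p (Y 4) * q (Y 5) - p (Y 5) * q (Y 4)) * r (X 3)"
  unfolding form_coord_expand by (simp add: mult_coord_def algebra_simps)

lemma form_coord_mult_coord_cyclic:
  "form_coord (mult_coord p q) r = form_coord (mult_coord q r) p"
  unfolding form_coord_mult_coord by (simp add: algebra_simps)

lemma exists_presented_model:
  "\<exists>(form\<^sub>0 :: 'a::field^10 \<Rightarrow> 'a^10 \<Rightarrow> 'a) mul\<^sub>0.
     symplectic_alternating_algebra (*s) form\<^sub>0 mul\<^sub>0 \<and>
     symplectic_alternating_algebra.has_presentation (*s) form\<^sub>0 mul\<^sub>0 5 presentation_10_2_3"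
proof -
  \<comment> \<open>The index type has ten elements, as many as there are labels; an arbitrary
    bijection turns vectors into coordinate functions on labels.\<close>
  obtain g :: "basis_label \<Rightarrow> 10" where g: "bij_betw g (basis_labels 5) UNIV"
    using finite_same_card_bij [OF finite_basis_labels [of 5], of "UNIV :: 10 set"]
    by (auto simp: card_basis_labels)
  define c :: "'a^10 \<Rightarrow> basis_label \<Rightarrow> 'a" where "c v = (\<lambda>l. v $ g l)" for v
  define form\<^sub>0 where "form\<^sub>0 u v = form_coord (c u) (c v)" for u v
  define mul\<^sub>0 :: "'a^10 \<Rightarrow> 'a^10 \<Rightarrow> 'a^10"
    where "mul\<^sub>0 u v = (\<chi> k. mult_coord (c u) (c v) (the_inv_into (basis_labels 5) g k))" for u v
  define e :: "basis_label \<Rightarrow> 'a^10" where "e l = axis (g l) 1" for l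
  have c_linear: "c (u + v) = (\<lambda>l. c u l + c v l)" "c (t *s v) = (\<lambda>l. t * c v l)" for u v t
    by (simp_all add: c_def)
  have c_e: "c (e l) m = (if m = l then 1 else 0)" if "l \<in> basis_labels 5" "m \<in> basis_labels 5" for l m
    using that g by (auto simp: c_def e_def axis_def bij_betw_def inj_on_def)
  have c_mul: "c (mul\<^sub>0 u v) l = mult_coord (c u) (c v) l" if "l \<in> basis_labels 5" for u v l
    using that g by (simp add: c_def mul\<^sub>0_def the_inv_into_f_f bij_betw_def)
  have form_mul: "form\<^sub>0 (mul\<^sub>0 u v) w = form_coord (mult_coord (c u) (c v)) (c w)" for u v w
    unfolding form\<^sub>0_def by (rule form_coord_cong) (simp_all add: c_mul)
  have c_eqI: "u = v" if "\<And>l. l \<in> basis_labels 5 \<Longrightarrow> c u l = c v l" for u v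
  proof -
    have "u $ k = v $ k" for k
      using that [of "the_inv_into (basis_labels 5) g k"] g
      by (simp add: c_def bij_betw_def the_inv_into_into f_the_inv_into_f)
    then show ?thesis by (simp add: vec_eq_iff)
  qed
  have c_zero: "c 0 l = 0" for l
    by (simp add: c_def)
  have e: "c (e (X i)) (Y j) = 0" "c (e (Y i)) (X j) = 0" "c (e (X i)) (X j) = (if i = j then 1 else 0)"
    "c (e (Y i)) (Y j) = (if i = j then 1 else 0)" if "i \<in> {1..5}" "j \<in> {1..5}" for i j
    using that c_e [of "X i" "Y j"] c_e [of "Y i" "X j"] c_e [of "X i" "X j"] c_e [of "Y i" "Y j"]
    by (auto simp: basis_labels_def)
  have form_e: "form\<^sub>0 u (e (Y i)) = c u (X i)" "form\<^sub>0 u (e (X i)) = - c u (Y i)" if "i \<in> {1..5}" for i u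
  proof -
    have i: "i = 1 \<or> i = 2 \<or> i = 3 \<or> i = 4 \<or> i = 5"
      using that unfolding atLeastAtMost_iff by presburger
    show "form\<^sub>0 u (e (Y i)) = c u (X i)" "form\<^sub>0 u (e (X i)) = - c u (Y i)"
      using i by (elim disjE; simp add: form\<^sub>0_def form_coord_expand e)+
  qed
  have saa: "symplectic_alternating_algebra (*s) form\<^sub>0 mul\<^sub>0"
  proof (intro symplectic_alternating_algebra.intro symplectic_alternating_algebra_axioms.intro)
    show "vector_space ((*s) :: 'a \<Rightarrow> 'a^10 \<Rightarrow> 'a^10)"
      by (rule vec.vector_space_axioms)
    show "\<exists>B :: ('a^10) set. finite B \<and> vec.span B = UNIV"
      using vec.finite_Basis span_cart_basis by blast
    have "Vector_Spaces.linear (*s) (*) (\<lambda>x. form\<^sub>0 x y) \<and> Vector_Spaces.linear (*s) (*) (\<lambda>x. form\<^sub>0 y x)" for y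
      unfolding Vector_Spaces.linear_iff form\<^sub>0_def c_linear form_coord_linear
      by (auto intro: vec.vector_space_axioms vector_space_over_itself.vector_space_axioms)
    then show "Vector_Spaces.linear (*s) (*) (\<lambda>x. form\<^sub>0 x y)"
      and "Vector_Spaces.linear (*s) (*) (\<lambda>y. form\<^sub>0 x y)" for x y
      by auto
    show "form\<^sub>0 x x = 0" for x
      by (simp add: form\<^sub>0_def form_coord_def mult.commute)
    show "x = 0" if "\<forall>y. form\<^sub>0 x y = 0" for x
    proof (rule c_eqI)
      fix l assume "l \<in> basis_labels 5"
      then show "c x l = c 0 l"
        using that form_e [of _ x] unfolding basis_labels_def by (auto simp: c_zero)
    qed
    have "Vector_Spaces.linear (*s) (*s) (\<lambda>x. mul\<^sub>0 x y) \<and> Vector_Spaces.linear (*s) (*s) (\<lambda>x. mul\<^sub>0 y x)" for y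
      unfolding Vector_Spaces.linear_iff
      by (auto intro: vec.vector_space_axioms simp: mul\<^sub>0_def c_linear mult_coord_linear vec_eq_iff)
    then show "Vector_Spaces.linear (*s) (*s) (\<lambda>x. mul\<^sub>0 x y)"
      and "Vector_Spaces.linear (*s) (*s) (\<lambda>y. mul\<^sub>0 x y)" for x y
      by auto
    show "mul\<^sub>0 x x = 0" for x
      by (rule c_eqI) (simp add: c_mul c_zero mult_coord_def mult.commute)
    show "form\<^sub>0 (mul\<^sub>0 x y) z = form\<^sub>0 (mul\<^sub>0 y z) x" for x y z
      unfolding form_mul by (rule form_coord_mult_coord_cyclic)
  qed
  interpret symplectic_alternating_algebra "(*s)" form\<^sub>0 mul\<^sub>0 by (rule saa)
  have "symplectic_frame 5 (\<lambda>i. e (X i)) (\<lambda>i. e (Y i))"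
    unfolding symplectic_frame_def by (auto simp: form_e e)
  moreover have "mul\<^sub>0 (e (X i)) (e (X j)) = 0" if "i \<in> {1..5}" "j \<in> {1..5}" for i j
    by (rule c_eqI) (use that in \<open>simp add: c_mul c_zero mult_coord_def e\<close>)
  moreover have "\<forall>i\<in>{1..5}. \<forall>j\<in>{1..5}. \<forall>k\<in>{1..5}. j < k \<longrightarrow>
      form\<^sub>0 (mul\<^sub>0 (e (X i)) (e (Y j))) (e (Y k)) = (if j = i + 1 \<and> k = 5 then 1 else 0)"
    unfolding ball_1_5 form_mul form_coord_mult_coord by (simp add: e)
  moreover have "\<forall>i\<in>{1..5}. \<forall>j\<in>{1..5}. \<forall>k\<in>{1..5}. i < j \<longrightarrow> j < k \<longrightarrow>
      form\<^sub>0 (mul\<^sub>0 (e (Y i)) (e (Y j))) (e (Y k)) = (if i = 1 \<and> j = 2 \<and> k = 4 then 1 else 0)"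
    unfolding ball_1_5 form_mul form_coord_mult_coord by (simp add: e)
  ultimately have "normal_frame (\<lambda>i. e (X i)) (\<lambda>i. e (Y i))"
    unfolding normal_frame_def by blast
  then have "has_presentation 5 presentation_10_2_3"
    by (rule presentation_of_normal_frame) (subst vec_dim_card, simp)
  then show ?thesis using saa by blast
qed

lemma (in symplectic_alternating_algebra) presented_saa_of_presentation:
  assumes "has_presentation 5 presentation_10_2_3"
  obtains b where "presented_saa smul form mul b"
proof -
  obtain b where "standard_basis 5 b" "normal_frame (\<lambda>i. b (X i)) (\<lambda>i. b (Y i))"
    using normal_frame_of_presentation assms by blast
  then have "presented_saa smul form mul b"
    by unfold_locales
  then show thesis by (rule that)
qed

lemma (in saa_10_2_3) has_presentation_10_2_3: "has_presentation 5 presentation_10_2_3"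
  using exists_adapted_frame exists_normal_frame presentation_of_normal_frame dim_eq_10 by blast

text \<open>A carrier is a type, so existence is asserted on the concrete space of ten-tuples over
  the given field, while uniqueness compares algebras on two arbitrary carriers.\<close>

theorem proposition3p3:
  fixes smul :: "'a::field \<Rightarrow> 'v::ab_group_add \<Rightarrow> 'v"
    and form :: "'v \<Rightarrow> 'v \<Rightarrow> 'a"
    and mul :: "'v \<Rightarrow> 'v \<Rightarrow> 'v"
    and smul' :: "'a \<Rightarrow> 'w::ab_group_add \<Rightarrow> 'w"
    and form' :: "'w \<Rightarrow> 'w \<Rightarrow> 'a"
    and mul' :: "'w \<Rightarrow> 'w \<Rightarrow> 'w"
  shows "(\<exists>(form\<^sub>0 :: 'a^10 \<Rightarrow> 'a^10 \<Rightarrow> 'a) mul\<^sub>0. saa_10_2_3 (*s) form\<^sub>0 mul\<^sub>0) \<and>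
    (saa_10_2_3 smul form mul \<longrightarrow> saa_10_2_3 smul' form' mul' \<longrightarrow>
       saa_isomorphic smul form mul smul' form' mul') \<and>
    (symplectic_alternating_algebra smul form mul \<longrightarrow>
       (saa_10_2_3 smul form mul \<longleftrightarrow>
        symplectic_alternating_algebra.has_presentation smul form mul 5 presentation_10_2_3))"
proof (intro conjI impI)
  obtain form\<^sub>0 :: "'a^10 \<Rightarrow> 'a^10 \<Rightarrow> 'a" and mul\<^sub>0 where
    saa: "symplectic_alternating_algebra (*s) form\<^sub>0 mul\<^sub>0" and
    "symplectic_alternating_algebra.has_presentation (*s) form\<^sub>0 mul\<^sub>0 5 presentation_10_2_3"
    using exists_presented_model by blast
  interpret M: symplectic_alternating_algebra "(*s)" form\<^sub>0 mul\<^sub>0 by (rule saa)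
  have "M.has_presentation 5 presentation_10_2_3" by fact
  then obtain b where "presented_saa (*s) form\<^sub>0 mul\<^sub>0 b"
    by (rule M.presented_saa_of_presentation)
  then show "\<exists>(form\<^sub>0 :: 'a^10 \<Rightarrow> 'a^10 \<Rightarrow> 'a) mul\<^sub>0. saa_10_2_3 (*s) form\<^sub>0 mul\<^sub>0"
    using presented_saa.presented_saa_10_2_3 by blast
next
  assume "saa_10_2_3 smul form mul" "saa_10_2_3 smul' form' mul'"
  then interpret A: saa_10_2_3 smul form mul + B: saa_10_2_3 smul' form' mul' .
  obtain b where b: "presented_saa smul form mul b"
    using A.presented_saa_of_presentation A.has_presentation_10_2_3 by blast
  obtain b' where b': "presented_saa smul' form' mul' b'"
    using B.presented_saa_of_presentation B.has_presentation_10_2_3 by blast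
  show "saa_isomorphic smul form mul smul' form' mul'"
    using b b' by (rule presented_saa_isomorphic)
next
  assume "symplectic_alternating_algebra smul form mul"
  then interpret symplectic_alternating_algebra smul form mul .
  show "saa_10_2_3 smul form mul \<longleftrightarrow> has_presentation 5 presentation_10_2_3"
    using presented_saa_of_presentation presented_saa.presented_saa_10_2_3
      saa_10_2_3.has_presentation_10_2_3 by metis
qed

end
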